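(* Consider an ROS system with two bidders (and any finite number of items) in the smooth limit, with dynamics $\frac{dm_i}{dt}=U_i(m)$, $i=1,2$. If $m_0\in(1,\infty)^2$ and the forward orbit of the solution with $m(0)=m_0$ is bounded, then $m(t)$ converges, as $t\to\infty$, to an equilibrium, i.e., to a point $m^*$ with $U_1(m^* )=U_2(m^* )=0$.
   Context: ROS system: $n$ bidders (here $n=2$), $k$ items; bidder $i$ uses multiplier $m_i$ and bids $b_{ij}=m_iv_{ij}$ on item $j$. Each item is sold by a second-price auction with uniform random tie-breaking: the highest bid wins (ties split uniformly), allocation $x_{ij}\in[0,1]$ is the winning probability and payment $p_{ij}=x_{ij}\max_{s\ne i}b_{sj}$. Smooth limit: the valuation vector $v=(v_{ij})$ is random with a positive $C^1$ density on a box $[0,M]^{nk}$ and $U_i(m)=\mathbb E[\sum_j v_{ij}x_{ij}(m)-p_{ij}(m)]$, a $C^1$ function of $m$. *)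

theory Defs
  imports "HOL-Analysis.Analysis"
begin

text \<open>Two bidders, items indexed by a finite type 'k. A valuation profile is a pair
  (v1, v2) of vectors in real^'k: v1 $ j is bidder 1's value for item j.\<close>

text \<open>Second-price auction with uniform tie-breaking: winning probability of a bid
  b_own against the competing bid b_other.\<close>
definition sp_alloc :: "real \<Rightarrow> real \<Rightarrow> real" where
  "sp_alloc b_own b_other =
     (if b_own > b_other then 1 else if b_own = b_other then 1/2 else 0)"

text \<open>Realized quasi-linear utility of a bidder with value vector vown, multiplier mown,
  facing the other bidder with value vector voth and multiplier moth:
  sum over items of v x - p, with p = x * (competing bid).\<close>
definition ros_util :: "real \<Rightarrow> real \<Rightarrow> real^'k::finite \<Rightarrow> real^'k \<Rightarrow> real" where
  "ros_util mown moth vown voth =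
     (\<Sum>j\<in>UNIV. vown $ j * sp_alloc (mown * vown $ j) (moth * voth $ j)
               - sp_alloc (mown * vown $ j) (moth * voth $ j) * (moth * voth $ j))"

definition val_box :: "real \<Rightarrow> ((real^'k::finite) \<times> (real^'k)) set" where
  "val_box M = {(v1, v2). \<forall>j. 0 \<le> v1 $ j \<and> v1 $ j \<le> M \<and> 0 \<le> v2 $ j \<and> v2 $ j \<le> M}"

definition U1 :: "real \<Rightarrow> ((real^'k::finite) \<times> (real^'k) \<Rightarrow> real) \<Rightarrow> real \<times> real \<Rightarrow> real" where
  "U1 M f m = integral (val_box M) (\<lambda>(v1, v2). f (v1, v2) * ros_util (fst m) (snd m) v1 v2)"

definition U2 :: "real \<Rightarrow> ((real^'k::finite) \<times> (real^'k) \<Rightarrow> real) \<Rightarrow> real \<times> real \<Rightarrow> real" where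
  "U2 M f m = integral (val_box M) (\<lambda>(v1, v2). f (v1, v2) * ros_util (snd m) (fst m) v2 v1)"

definition smooth_density :: "real \<Rightarrow> ((real^'k::finite) \<times> (real^'k) \<Rightarrow> real) \<Rightarrow> bool" where
  "smooth_density M f \<longleftrightarrow> M > 0 \<and>
     (\<exists>S f'. open S \<and> val_box M \<subseteq> S \<and>
        (\<forall>x\<in>S. (f has_derivative blinfun_apply (f' x)) (at x)) \<and> continuous_on S f') \<and>
     (\<forall>v\<in>val_box M. f v > 0) \<and>
     (f has_integral 1) (val_box M)"

end

theory Submission
  imports Defs
begin

text \<open>Since an item is won according to the ratio of the bids only, the system is governed by a
  single function: the law of \<open>v2 / v1\<close> under the density weighted by \<open>v1\<close>, summed over the
  items, has a continuous positive density \<open>g\<close>, and with \<open>r = m1 / m2\<close>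

  \<open>U1 = \<integral> (1 - m2 u) g(u) du\<close> over \<open>u < r\<close>, \<open>U2 = \<integral> (u - m1) g(u) du\<close> over \<open>u > r\<close>.

  The region \<open>m1, m2 > 1\<close> is forward invariant. In the coordinates \<open>r\<close> and \<open>s = m2\<close> the flow is
  \<open>s r' = a(r) - b(r) s\<close>, \<open>s' = A2(r) - r s B2(r)\<close>, so it suffices that \<open>r\<close> converges. Otherwise
  \<open>r\<close> sweeps a whole interval infinitely often in both directions. On this interval \<open>b\<close> has no
  zero, because common zeros of \<open>a\<close> and \<open>b\<close> give invariant rays, and the nullcline
  \<open>\<sigma> = a / b\<close> of \<open>r\<close> stays in the region \<open>m1, m2 > 1\<close>. There the negative divergence of the
  vector field yields a strict Lyapunov function of the form \<open>b s^2 / 2 - a s + W(r)\<close>. Its convergence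
  forces \<open>s\<close> to approach \<open>\<sigma>(r)\<close>, so its value on the nullcline is constant, which means that
  the nullcline consists of equilibria over the interval. Then \<open>ln s - R(r)\<close>, where
  \<open>R' = r B2 / b\<close>, is conserved while the orbit crosses the interval, so \<open>ln \<sigma> - R\<close> is constant
  too; differentiating contradicts the negativity of the divergence.\<close>

section \<open>Real functions at infinity\<close>

lemma last_level_time:
  fixes f :: "real \<Rightarrow> real"
  assumes "u \<le> v" and cont: "continuous_on {u..v} f" and "f u \<le> p" "p \<le> f v"
  obtains t where "t \<in> {u..v}" "f t = p" "\<And>\<tau>. \<tau> \<in> {t..v} \<Longrightarrow> p \<le> f \<tau>"
proof -
  \<comment> \<open>The level set is compact, so it has a last point; a value below \<open>p\<close>
    after that point would produce a still later passage through \<open>p\<close> by the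
    intermediate value theorem.\<close>
  let ?S = "{\<tau> \<in> {u..v}. f \<tau> = p}"
  have "?S = {u..v} \<inter> f -` {p}" by auto
  moreover have "closed ({u..v} \<inter> f -` {p})" by (rule continuous_closed_preimage[OF cont]) auto
  then have "compact ({u..v} \<inter> ({u..v} \<inter> f -` {p}))" by (intro compact_Int_closed) auto
  ultimately have "compact ?S" by (simp add: Int_assoc[symmetric])
  moreover have "?S \<noteq> {}" using IVT'[of f u p v] assms by auto
  ultimately have "\<exists>t\<in>?S. \<forall>\<tau>\<in>?S. \<tau> \<le> t" by (rule compact_attains_sup)
  then obtain t where t: "t \<in> ?S" "\<forall>\<tau>\<in>?S. \<tau> \<le> t" by (elim bexE)
  show ?thesis
  proof (rule that[of t])
    fix \<tau> assume \<tau>: "\<tau> \<in> {t..v}"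
    show "p \<le> f \<tau>"
    proof (rule ccontr)
      assume "\<not> p \<le> f \<tau>"
      moreover have "continuous_on {\<tau>..v} f" by (rule continuous_on_subset[OF cont]) (use \<tau> t in auto)
      ultimately obtain z where "\<tau> \<le> z" "z \<le> v" "f z = p" using IVT'[of f \<tau> p v] assms \<tau> by auto
      then have "z \<le> t" using t \<tau> by auto
      then have "\<tau> = t" using \<open>\<tau> \<le> z\<close> \<tau> by auto
      then show False using \<open>\<not> p \<le> f \<tau>\<close> t by auto
    qed
  qed (use t in auto)
qed

text \<open>Reversing both time and sign turns a last passage into a first one.\<close>

lemma first_level_time:
  fixes f :: "real \<Rightarrow> real"
  assumes "u \<le> v" and cont: "continuous_on {u..v} f" and "f u \<le> q" "q \<le> f v"
  obtains t where "t \<in> {u..v}" "f t = q" "\<And>\<tau>. \<tau> \<in> {u..t} \<Longrightarrow> f \<tau> \<le> q"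
proof -
  have "continuous_on {-v..-u} (\<lambda>t. - f (- t))"
    by (intro continuous_intros continuous_on_compose2[OF cont]) auto
  with assms obtain t where t: "t \<in> {-v..-u}" "- f (- t) = - q" "\<And>\<tau>. \<tau> \<in> {t..-u} \<Longrightarrow> - q \<le> - f (- \<tau>)"
    using last_level_time[of "-v" "-u" "\<lambda>t. - f (- t)" "- q"] by auto
  show ?thesis
  proof (rule that[of "- t"])
    show "f \<tau> \<le> q" if "\<tau> \<in> {u..-t}" for \<tau> using t(3)[of "- \<tau>"] that by auto
  qed (use t in auto)
qed

text \<open>Take the last passage through \<open>p\<close>, then the first passage through
  \<open>q\<close> after it: in between, neither level can be crossed.\<close>

lemma strip_crossing_times:
  fixes f :: "real \<Rightarrow> real"
  assumes "u \<le> v" and cont: "continuous_on {u..v} f" and "f u \<le> p" "p < q" "q \<le> f v"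
  obtains t t' where "u \<le> t" "t < t'" "t' \<le> v" "f t = p" "f t' = q" "\<And>\<tau>. \<tau> \<in> {t..t'} \<Longrightarrow> f \<tau> \<in> {p..q}"
proof -
  obtain t where t: "t \<in> {u..v}" "f t = p" "\<And>\<tau>. \<tau> \<in> {t..v} \<Longrightarrow> p \<le> f \<tau>"
    using last_level_time[OF assms(1,2,3)] assms by (metis less_le_trans less_imp_le)
  have "continuous_on {t..v} f" by (rule continuous_on_subset[OF cont]) (use t in auto)
  then obtain t' where t': "t' \<in> {t..v}" "f t' = q" "\<And>\<tau>. \<tau> \<in> {t..t'} \<Longrightarrow> f \<tau> \<le> q"
    using first_level_time[of t v f q] t assms by auto
  have "t \<noteq> t'" using t t' assms by auto
  then show ?thesis using that[of t t'] t t' by fastforce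
qed

text \<open>At the last passage through \<open>p\<close> a negative derivative would push
  \<open>f\<close> below \<open>p\<close> immediately afterwards, although \<open>f\<close> stays
  above \<open>p\<close> from then on.\<close>

lemma level_time_deriv_nonneg:
  fixes f :: "real \<Rightarrow> real"
  assumes "u \<le> v" "f u < p" "p < f v"
    and der: "\<And>t. t \<in> {u..v} \<Longrightarrow> (f has_real_derivative f' t) (at t)"
  obtains t where "t \<in> {u..v}" "f t = p" "f' t \<ge> 0"
proof -
  have "continuous_on {u..v} f"
    by (intro continuous_at_imp_continuous_on ballI DERIV_isCont) (use der in auto)
  then obtain t where t: "t \<in> {u..v}" "f t = p" "\<And>\<tau>. \<tau> \<in> {t..v} \<Longrightarrow> p \<le> f \<tau>"
    using last_level_time[of u v f p] assms by auto
  have "f' t \<ge> 0"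
  proof (rule ccontr)
    assume "\<not> f' t \<ge> 0"
    then obtain d where d: "d > 0" "\<And>h. h > 0 \<Longrightarrow> h < d \<Longrightarrow> f (t + h) < f t"
      using DERIV_neg_dec_right[OF der[OF t(1)]] by auto
    have "t < v" using t assms by (metis atLeastAtMost_iff order_less_le)
    define h where "h = min (d/2) (v - t)"
    have "h > 0" "h < d" "t + h \<in> {t..v}" using d \<open>t < v\<close> by (auto simp: h_def min_def)
    then show False using d(2)[of h] t(2) t(3)[of "t + h"] by simp
  qed
  then show ?thesis using that t by blast
qed

section \<open>Limits, oscillation and monotone convergence at infinity\<close>

lemma oscillation_bounds:
  fixes f :: "real \<Rightarrow> real"
  assumes bounds: "\<forall>\<^sub>F t in at_top. lo \<le> f t \<and> f t \<le> hi" and nonconv: "\<not> (\<exists>l. (f \<longlongrightarrow> l) at_top)"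
  obtains r1 r2 where "r1 < r2"
    "\<And>x. x < r1 \<Longrightarrow> \<forall>\<^sub>F t in at_top. x < f t" "\<And>x. x > r2 \<Longrightarrow> \<forall>\<^sub>F t in at_top. f t < x"
    "\<And>x. x > r1 \<Longrightarrow> \<exists>\<^sub>F t in at_top. f t < x" "\<And>x. x < r2 \<Longrightarrow> \<exists>\<^sub>F t in at_top. x < f t"
proof -
  define S1 where "S1 = {x. \<forall>\<^sub>F t in at_top. x < f t}"
  define S2 where "S2 = {x. \<forall>\<^sub>F t in at_top. f t < x}"
  have lt: "x < y" if "x \<in> S1" "y \<in> S2" for x y
  proof -
    have "\<forall>\<^sub>F t in at_top. x < f t \<and> f t < y" using that by (simp add: S1_def S2_def eventually_conj)
    then show ?thesis by (auto dest!: eventually_happens'[rotated])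
  qed
  have ne: "lo - 1 \<in> S1" "hi + 1 \<in> S2"
    unfolding S1_def S2_def using bounds by (auto elim: eventually_mono)
  have bdd: "bdd_above S1" "bdd_below S2"
    using lt[OF _ ne(2)] lt[OF ne(1)] by (meson bdd_aboveI bdd_belowI less_imp_le)+
  \<comment> \<open>These are the lower and upper limits of \<open>f\<close>, written as extremal
    eventual strict bounds so that they are real numbers. If they coincided, \<open>f\<close> would
    converge.\<close>
  define r1 where "r1 = Sup S1"
  define r2 where "r2 = Inf S2"
  have S1_ne: "S1 \<noteq> {}" and S2_ne: "S2 \<noteq> {}" using ne by auto
  have 1: "\<forall>\<^sub>F t in at_top. x < f t" if x: "x < r1" for x
  proof -
    obtain y where "y \<in> S1" "x < y" using less_cSupD[OF S1_ne x[unfolded r1_def]] by auto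
    then have "\<forall>\<^sub>F t in at_top. y < f t" by (simp add: S1_def)
    then show ?thesis by (rule eventually_mono) (use \<open>x < y\<close> in simp)
  qed
  have 2: "\<forall>\<^sub>F t in at_top. f t < x" if x: "r2 < x" for x
  proof -
    obtain y where "y \<in> S2" "y < x" using cInf_lessD[OF S2_ne x[unfolded r2_def]] by auto
    then have "\<forall>\<^sub>F t in at_top. f t < y" by (simp add: S2_def)
    then show ?thesis by (rule eventually_mono) (use \<open>y < x\<close> in simp)
  qed
  have 3: "\<exists>\<^sub>F t in at_top. f t < x" if x: "r1 < x" for x
  proof -
    obtain y where y: "r1 < y" "y < x" using dense[OF x] by auto
    then have "y \<notin> S1" using cSup_upper[OF _ bdd(1), of y] unfolding r1_def by auto
    then have "\<exists>\<^sub>F t in at_top. \<not> y < f t" unfolding S1_def by (simp add: not_eventually)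
    then show ?thesis by (rule frequently_elim1) (use y in auto)
  qed
  have 4: "\<exists>\<^sub>F t in at_top. x < f t" if x: "x < r2" for x
  proof -
    obtain y where y: "x < y" "y < r2" using dense[OF x] by auto
    then have "y \<notin> S2" using cInf_lower[OF _ bdd(2), of y] unfolding r2_def by auto
    then have "\<exists>\<^sub>F t in at_top. \<not> f t < y" unfolding S2_def by (simp add: not_eventually)
    then show ?thesis by (rule frequently_elim1) (use y in auto)
  qed
  have "r1 < r2"
  proof (rule ccontr)
    assume "\<not> r1 < r2"
    moreover have "\<not> r2 < r1"
    proof
      assume "r2 < r1"
      then obtain y where y: "r2 < y" "y < r1" using dense by auto
      then have "y \<in> S1" "y \<in> S2" using 1 2 by (auto simp: S1_def S2_def)
      then show False using lt by blast
    qed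
    ultimately have "(f \<longlongrightarrow> r1) at_top" using 1 2 by (intro order_tendstoI) auto
    then show False using nonconv by blast
  qed
  from that[OF this 1 2 3 4] show ?thesis .
qed

lemma frequently_at_top_real_obtain:
  fixes T :: real
  assumes "\<exists>\<^sub>F t in at_top. P t"
  obtains t where "t > T" "P t"
  using frequently_ex[OF frequently_eventually_frequently[OF assms eventually_gt_at_top[of T]]] that by auto

text \<open>For a monotone function a bound at arbitrarily late times is a bound at all times. This
  weak form suits the Lyapunov function, which is only estimated at the times when the orbit meets
  one fixed ray.\<close>

lemma increasing_convergent_at_top:
  fixes K :: "real \<Rightarrow> real"
  assumes mono: "\<And>t t'. T \<le> t \<Longrightarrow> t \<le> t' \<Longrightarrow> K t \<le> K t'" and freq: "\<exists>\<^sub>F t in at_top. K t \<le> Z"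
  obtains k where "(K \<longlongrightarrow> k) at_top"
proof -
  have le: "K t \<le> Z" if "t \<ge> T" for t
  proof -
    obtain t' where "t' > t" "K t' \<le> Z" using frequently_at_top_real_obtain[OF freq] by blast
    then show ?thesis using mono[OF that, of t'] by simp
  qed
  have bdd: "bdd_above (K ` {T..})" using le by (auto simp: bdd_above_def)
  have "(K \<longlongrightarrow> Sup (K ` {T..})) at_top"
  proof (rule order_tendstoI)
    fix y assume "y < Sup (K ` {T..})"
    then obtain t0 where "t0 \<ge> T" "y < K t0" using less_cSupD[of "K ` {T..}" y] by auto
    then have "y < K t" if "t \<ge> t0" for t using mono[of t0 t] that by simp
    then show "\<forall>\<^sub>F t in at_top. y < K t" by (auto simp: eventually_at_top_linorder)
  next
    fix y assume "Sup (K ` {T..}) < y"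
    then have "K t < y" if "t \<ge> T" for t using cSup_upper[OF _ bdd, of "K t"] that by force
    then show "\<forall>\<^sub>F t in at_top. K t < y" by (auto simp: eventually_at_top_linorder)
  qed
  then show ?thesis using that by blast
qed

text \<open>A LaSalle-type argument: each late visit near \<open>z\<close> lasts at least a fixed
  time because the speed is at most \<open>V\<close>, and during that time \<open>K\<close> gains at
  least a fixed amount, which a convergent \<open>K\<close> cannot do late in time.\<close>

lemma convergent_imp_avoids_pos_deriv:
  fixes K :: "real \<Rightarrow> real" and p :: "real \<Rightarrow> 'a::metric_space" and D :: "'a \<Rightarrow> real"
  assumes lim: "(K \<longlongrightarrow> k) at_top"
    and der: "\<And>t. t \<ge> T \<Longrightarrow> (K has_real_derivative D (p t)) (at t)"
    and lip: "\<And>t t'. T \<le> t \<Longrightarrow> t \<le> t' \<Longrightarrow> dist (p t) (p t') \<le> V * (t' - t)" and V: "V > 0"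
    and D: "isCont D z" "D z > 0"
  obtains \<delta> where "\<delta> > 0" "\<forall>\<^sub>F t in at_top. dist (p t) z \<ge> \<delta>"
proof -
  define c where "c = D z / 2"
  have c: "c > 0" using D by (simp add: c_def)
  have "(D \<longlongrightarrow> D z) (nhds z)" using D by (simp add: continuous_at tendsto_at_iff_tendsto_nhds)
  then have "\<forall>\<^sub>F y in nhds z. c < D y"
    by (rule order_tendstoD) (use D in \<open>simp add: c_def\<close>)
  then obtain \<delta>' where \<delta>': "\<delta>' > 0" "\<And>y. dist y z < \<delta>' \<Longrightarrow> c < D y"
    by (auto simp: eventually_nhds_metric)
  \<comment> \<open>Starting within \<delta> of \<open>z\<close> and moving for time \<eta> covers
    at most another \<delta>, so the path stays in the ball of radius \<delta>' on which
    \<open>D\<close> exceeds \<open>c\<close>.\<close>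
  define \<delta> where "\<delta> = \<delta>' / 2"
  define \<eta> where "\<eta> = \<delta> / V"
  have pos: "\<delta> > 0" "\<eta> > 0" using \<delta>' V by (auto simp: \<delta>_def \<eta>_def)
  have "\<forall>\<^sub>F t in at_top. dist (K t) k < c * \<eta> / 2" using lim c pos by (intro tendstoD) auto
  then obtain T' where T': "\<And>t. t \<ge> T' \<Longrightarrow> dist (K t) k < c * \<eta> / 2"
    by (auto simp: eventually_at_top_linorder)
  have "dist (p t) z \<ge> \<delta>" if t: "t \<ge> max T T'" for t
  proof (rule ccontr)
    assume "\<not> dist (p t) z \<ge> \<delta>"
    have close: "dist (p \<tau>) z < \<delta>'" if "t \<le> \<tau>" "\<tau> \<le> t + \<eta>" for \<tau>
    proof -
      have "dist (p t) (p \<tau>) \<le> V * (\<tau> - t)" using lip that t by auto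
      also have "\<dots> \<le> V * \<eta>" using that V by simp
      also have "\<dots> = \<delta>" using V by (simp add: \<eta>_def)
      finally have "dist (p t) (p \<tau>) \<le> \<delta>" .
      then show ?thesis using \<open>\<not> dist (p t) z \<ge> \<delta>\<close> dist_triangle[of "p \<tau>" z "p t"]
        by (simp add: \<delta>_def dist_commute)
    qed
    have "K t - c * t \<le> K (t + \<eta>) - c * (t + \<eta>)"
    proof (rule DERIV_nonneg_imp_nondecreasing[where f = "\<lambda>\<tau>. K \<tau> - c * \<tau>"])
      fix \<tau> assume \<tau>: "t \<le> \<tau>" "\<tau> \<le> t + \<eta>"
      have "((\<lambda>\<tau>. K \<tau> - c * \<tau>) has_real_derivative D (p \<tau>) - c) (at \<tau>)"
        using der[of \<tau>] \<tau> t by (auto intro!: derivative_eq_intros)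
      then show "\<exists>y. ((\<lambda>\<tau>. K \<tau> - c * \<tau>) has_real_derivative y) (at \<tau>) \<and> 0 \<le> y"
        using \<delta>'(2)[OF close[OF \<tau>]] by force
    qed (use pos in simp)
    then have "c * \<eta> \<le> K (t + \<eta>) - K t" by (simp add: algebra_simps)
    moreover have "\<bar>K t - k\<bar> < c * \<eta> / 2" "\<bar>K (t + \<eta>) - k\<bar> < c * \<eta> / 2"
      using T'[of t] T'[of "t + \<eta>"] t pos by (auto simp: dist_real_def)
    ultimately show False by linarith
  qed
  then have "\<forall>\<^sub>F t in at_top. dist (p t) z \<ge> \<delta>" unfolding eventually_at_top_linorder by blast
  then show ?thesis using that[OF pos(1)] by simp
qed

section \<open>Calculus on open intervals\<close>

lemma open_interval_antiderivative:
  fixes h :: "real \<Rightarrow> real"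
  assumes "\<alpha> < \<beta>" "continuous_on {\<alpha><..<\<beta>} h"
  obtains H where "\<And>x. x \<in> {\<alpha><..<\<beta>} \<Longrightarrow> (H has_real_derivative h x) (at x)"
proof -
  have "isCont h x" if "x \<in> {\<alpha><..<\<beta>}" for x
    using assms(2) that by (simp add: continuous_on_eq_continuous_at)
  then have "\<exists>F. \<forall>x. ereal \<alpha> < ereal x \<longrightarrow> ereal x < ereal \<beta> \<longrightarrow> (F has_vector_derivative h x) (at x)"
    by (intro einterval_antiderivative) (use assms in auto)
  then show ?thesis using that by (auto simp: has_real_derivative_iff_has_vector_derivative)
qed

lemma has_real_derivative_const_on_open_unique:
  fixes h :: "real \<Rightarrow> real"
  assumes "open S" "x \<in> S" "\<And>y. y \<in> S \<Longrightarrow> h y = k" "(h has_real_derivative D) (at x)"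
  shows "D = 0"
proof -
  have "((\<lambda>_. k) has_real_derivative 0) (at x)" by simp
  then have "(h has_real_derivative 0) (at x)"
    by (rule has_field_derivative_transform_within_open[OF _ assms(1,2)]) (use assms in auto)
  then show ?thesis using assms(4) DERIV_unique by blast
qed

lemma same_sign_on_interval:
  fixes b :: "real \<Rightarrow> real"
  assumes "continuous_on {\<alpha><..<\<beta>} b" "\<And>x. x \<in> {\<alpha><..<\<beta>} \<Longrightarrow> b x \<noteq> 0" "x \<in> {\<alpha><..<\<beta>}" "y \<in> {\<alpha><..<\<beta>}"
  shows "sgn (b x) = sgn (b y)"
proof (rule ccontr)
  assume ne: "sgn (b x) \<noteq> sgn (b y)"
  have conn: "connected (b ` {\<alpha><..<\<beta>})" by (rule connected_continuous_image[OF assms(1)]) simp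
  have nz: "b x \<noteq> 0" "b y \<noteq> 0" using assms by auto
  then have "b x \<le> 0 \<and> 0 \<le> b y \<or> b y \<le> 0 \<and> 0 \<le> b x" using ne by (auto simp: sgn_if split: if_splits)
  then have "0 \<in> b ` {\<alpha><..<\<beta>}"
    using connectedD_interval[OF conn imageI[OF assms(3)] imageI[OF assms(4)], of 0]
      connectedD_interval[OF conn imageI[OF assms(4)] imageI[OF assms(3)], of 0] by blast
  then show False using assms(2) by auto
qed

section \<open>Invariance and asymptotics for scalar differential equations\<close>

lemma stays_above_one:
  fixes p q :: "real \<Rightarrow> real"
  assumes cont: "continuous_on {0..} p" "continuous_on {0..} q" and init: "p 0 > 1" "q 0 > 1"
    and p: "\<And>t. t > 0 \<Longrightarrow> p t = 1 \<Longrightarrow> q t \<ge> 1 \<Longrightarrow> \<exists>D>0. (p has_real_derivative D) (at t)"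
    and q: "\<And>t. t > 0 \<Longrightarrow> q t = 1 \<Longrightarrow> p t \<ge> 1 \<Longrightarrow> \<exists>D>0. (q has_real_derivative D) (at t)"
    and t: "t \<ge> 0"
  shows "p t > 1 \<and> q t > 1"
proof (rule ccontr)
  assume bad: "\<not> (p t > 1 \<and> q t > 1)"
  \<comment> \<open>Consider the first time \<open>u\<close> at which the smaller of the two
    functions equals 1. That function then has a positive derivative, so it was below 1 shortly
    before, contradicting the choice of \<open>u\<close>.\<close>
  have "continuous_on {0..t} (\<lambda>u. - min (p u) (q u))"
    by (intro continuous_intros continuous_on_min continuous_on_subset[OF cont(1)] continuous_on_subset[OF cont(2)]) auto
  then obtain u where u: "u \<in> {0..t}" "- min (p u) (q u) = - 1" "\<And>w. w \<in> {0..u} \<Longrightarrow> - min (p w) (q w) \<le> - 1"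
    by (rule first_level_time[OF t, of "\<lambda>u. - min (p u) (q u)" "- 1"]) (use bad init in auto)
  have ge: "p w \<ge> 1" "q w \<ge> 1" if "w \<in> {0..u}" for w using u(3)[OF that] by auto
  have u0: "u > 0" using u init by (cases "u = 0") auto
  have no: False if h: "h u = 1" "\<And>w. w \<in> {0..u} \<Longrightarrow> h w \<ge> 1" "\<exists>D>0. (h has_real_derivative D) (at u)" for h :: "real \<Rightarrow> real"
  proof -
    obtain D where D: "D > 0" "(h has_real_derivative D) (at u)" using h(3) by blast
    obtain d where d: "d > 0" "\<And>k. k > 0 \<Longrightarrow> k < d \<Longrightarrow> h (u - k) < h u"
      using DERIV_pos_inc_left[OF D(2,1)] by blast
    define k where "k = min (d / 2) u"
    have "k > 0" "k < d" "u - k \<in> {0..u}" using d(1) u0 by (auto simp: k_def min_def)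
    then show False using d(2)[of k] h(2)[of "u - k"] h(1) by simp
  qed
  show False
  proof (cases "p u = 1")
    case True
    then show False using no[of p] ge p[OF u0] u by auto
  next
    case False
    then have "q u = 1" using u(2) by (auto simp: min_def split: if_splits)
    then show False using no[of q] ge q[OF u0] u by auto
  qed
qed

text \<open>Write \<open>y\<close> as the quotient of \<open>y t * exp (B * t)\<close> and
  \<open>exp (B * t)\<close> and apply l'Hospital's rule. The coefficient error
  \<open>(B - \<beta> t) * y t\<close> vanishes in the limit because \<open>y\<close> is
  bounded.\<close>

lemma linear_ode_limit:
  fixes y :: "real \<Rightarrow> real"
  assumes der: "\<And>t. t > 0 \<Longrightarrow> (y has_real_derivative \<alpha> t - \<beta> t * y t) (at t)"
    and lim: "(\<alpha> \<longlongrightarrow> A) at_top" "(\<beta> \<longlongrightarrow> B) at_top" and B: "B > 0"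
    and bdd: "\<And>t. t > 0 \<Longrightarrow> \<bar>y t\<bar> \<le> C"
  shows "(y \<longlongrightarrow> A / B) at_top"
proof -
  have small: "((\<lambda>t. (B - \<beta> t) * y t) \<longlongrightarrow> 0) at_top"
  proof (rule Lim_null_comparison)
    show "\<forall>\<^sub>F t in at_top. norm ((B - \<beta> t) * y t) \<le> \<bar>B - \<beta> t\<bar> * C"
      using eventually_gt_at_top[of 0] by eventually_elim (auto simp: abs_mult intro!: mult_left_mono bdd)
    have "((\<lambda>t. \<bar>B - \<beta> t\<bar> * C) \<longlongrightarrow> \<bar>B - B\<bar> * C) at_top" by (intro tendsto_intros lim)
    then show "((\<lambda>t. \<bar>B - \<beta> t\<bar> * C) \<longlongrightarrow> 0) at_top" by simp
  qed
  have "((\<lambda>t. (y t * exp (B * t)) / exp (B * t)) \<longlongrightarrow> A / B) at_top"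
  proof (rule lhospital_at_top_at_top)
    show "filterlim (\<lambda>t. exp (B * t)) at_top at_top"
      using B by (intro filterlim_compose[OF exp_at_top] filterlim_tendsto_pos_mult_at_top[OF tendsto_const]) (auto simp: filterlim_ident)
    show "\<forall>\<^sub>F t in at_top. B * exp (B * t) \<noteq> 0" using B by simp
    show "\<forall>\<^sub>F t in at_top. ((\<lambda>t. y t * exp (B * t)) has_real_derivative (\<alpha> t - \<beta> t * y t + B * y t) * exp (B * t)) (at t)"
      using eventually_gt_at_top[of 0]
      by eventually_elim (auto intro!: derivative_eq_intros der simp: algebra_simps)
    show "\<forall>\<^sub>F t in at_top. ((\<lambda>t. exp (B * t)) has_real_derivative B * exp (B * t)) (at t)"
      by (intro always_eventually allI) (auto intro!: derivative_eq_intros)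
    have "((\<lambda>t. (\<alpha> t + (B - \<beta> t) * y t) / B) \<longlongrightarrow> (A + 0) / B) at_top"
      using B by (intro tendsto_intros lim small) auto
    moreover have eq: "\<alpha> t - \<beta> t * y t + B * y t = \<alpha> t + (B - \<beta> t) * y t" for t
      by (simp add: algebra_simps)
    ultimately show "((\<lambda>t. (\<alpha> t - \<beta> t * y t + B * y t) * exp (B * t) / (B * exp (B * t))) \<longlongrightarrow> A / B) at_top"
      unfolding eq by simp
  qed
  then show ?thesis by simp
qed

text \<open>By l'Hospital's rule \<open>y t / t\<close> tends to \<open>L\<close>, while boundedness
  of \<open>y\<close> makes it tend to 0. This is how limits of orbits are recognised as
  equilibria.\<close>

lemma bounded_imp_deriv_limit_zero:
  fixes y :: "real \<Rightarrow> real"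
  assumes der: "\<And>t. t > 0 \<Longrightarrow> (y has_real_derivative y' t) (at t)"
    and lim: "(y' \<longlongrightarrow> L) at_top" and bdd: "\<And>t. t > 0 \<Longrightarrow> \<bar>y t\<bar> \<le> C"
  shows "L = 0"
proof -
  have "((\<lambda>t. y t / t) \<longlongrightarrow> L) at_top"
  proof (rule lhospital_at_top_at_top)
    show "filterlim (\<lambda>t::real. t) at_top at_top" by (rule filterlim_ident)
    show "\<forall>\<^sub>F t in at_top. (y has_real_derivative y' t) (at t)"
      using eventually_gt_at_top[of 0] by eventually_elim (rule der)
    show "((\<lambda>t. y' t / 1) \<longlongrightarrow> L) at_top" using lim by simp
  qed auto
  moreover have "((\<lambda>t. y t / t) \<longlongrightarrow> 0) at_top"
  proof (rule Lim_null_comparison)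
    show "\<forall>\<^sub>F t in at_top. norm (y t / t) \<le> C / t"
      using eventually_gt_at_top[of 0] by eventually_elim (auto simp: abs_divide intro!: divide_right_mono bdd)
    show "((\<lambda>t. C / t) \<longlongrightarrow> 0) at_top"
      by (rule tendsto_divide_0[OF tendsto_const]) (simp add: filterlim_at_top_imp_at_infinity filterlim_ident)
  qed
  ultimately show ?thesis by (rule tendsto_unique[OF trivial_limit_at_top_linorder])
qed

section \<open>The flow of the bid ratio\<close>

lemma abs_divide_le: "1 < y \<Longrightarrow> \<bar>x / y\<bar> \<le> \<bar>x\<bar>" for x y :: real
  using mult_left_mono[of 1 y "\<bar>x\<bar>"] by (simp add: abs_divide divide_le_eq)

text \<open>Here \<open>r\<close> is the ratio of the multipliers and \<open>s\<close> the second
  multiplier. In the application \<open>a x = A1 x - x * A2 x\<close> and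
  \<open>b x = B1 x - x\<^sup>2 * B2 x\<close>, where \<open>A1\<close>, \<open>B1\<close> have
  derivatives \<open>g x\<close>, \<open>g x * x\<close> and \<open>A2\<close>, \<open>B2\<close>
  their negatives, \<open>- (g x * x)\<close> and \<open>- g x\<close>; this gives the two
  derivative formulas.\<close>

locale ratio_flow =
  fixes a b A2 B2 g r s :: "real \<Rightarrow> real" and lo hi C :: real
  assumes lo: "0 < lo"
    and g_cont: "continuous_on {0<..} g" and g_pos: "\<And>x. x > 0 \<Longrightarrow> g x > 0"
    and A2_cont: "continuous_on {0<..} A2" and B2_cont: "continuous_on {0<..} B2"
    and a_deriv: "\<And>x. x > 0 \<Longrightarrow> (a has_real_derivative (1 + x\<^sup>2) * g x - A2 x) (at x)"
    and b_deriv: "\<And>x. x > 0 \<Longrightarrow> (b has_real_derivative (x + x\<^sup>2) * g x - 2 * x * B2 x) (at x)"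
    and r_deriv: "\<And>t. t > 0 \<Longrightarrow> (r has_real_derivative (a (r t) - b (r t) * s t) / s t) (at t)"
    and s_deriv: "\<And>t. t > 0 \<Longrightarrow> (s has_real_derivative A2 (r t) - r t * s t * B2 (r t)) (at t)"
    and r_bounds: "\<And>t. t > 0 \<Longrightarrow> r t \<in> {lo..hi}"
    and s_bounds: "\<And>t. t > 0 \<Longrightarrow> 1 < s t \<and> s t \<le> C"
    and rs_bound: "\<And>t. t > 0 \<Longrightarrow> 1 < r t * s t"
begin

text \<open>The ratio \<open>r\<close> is stationary exactly on the curve \<open>s = \<sigma> r\<close>; the region where both
  multipliers exceed 1 is \<open>s > \<tau> r\<close>.\<close>

definition \<sigma> :: "real \<Rightarrow> real" where "\<sigma> x = a x / b x"
definition \<tau> :: "real \<Rightarrow> real" where "\<tau> x = max 1 (1 / x)"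

lemma s_gt_\<tau>: "t > 0 \<Longrightarrow> \<tau> (r t) < s t"
  using s_bounds[of t] rs_bound[of t] r_bounds[of t] lo by (auto simp: \<tau>_def field_simps)

lemma a_cont: "continuous_on {0<..} a" and b_cont: "continuous_on {0<..} b"
  using a_deriv b_deriv by (auto intro!: continuous_at_imp_continuous_on DERIV_isCont)

lemma isCont_coeffs:
  assumes "x > 0" shows "isCont a x" "isCont b x" "isCont g x" "isCont A2 x" "isCont B2 x"
  using assms a_cont b_cont g_cont A2_cont B2_cont by (auto simp: continuous_on_eq_continuous_at)

lemma r_isCont: "t > 0 \<Longrightarrow> isCont r t"
  using r_deriv DERIV_isCont by blast

lemma bounded_on_range:
  assumes "continuous_on {0<..} h"
  obtains L where "L > 0" "\<And>x. x \<in> {lo..hi} \<Longrightarrow> \<bar>h x :: real\<bar> \<le> L"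
proof -
  have "continuous_on {lo..hi} h" by (rule continuous_on_subset[OF assms]) (use lo in auto)
  then have "bounded (h ` {lo..hi})" by (intro compact_imp_bounded compact_continuous_image) auto
  then show ?thesis using that unfolding bounded_pos by auto
qed

section \<open>Lipschitz bounds and invariant rays\<close>

lemma lipschitz_on_range:
  assumes der: "\<And>x. x > 0 \<Longrightarrow> (h has_real_derivative h' x) (at x)" and cont: "continuous_on {0<..} h'"
  obtains L where "L > 0" "\<And>x y. x \<in> {lo..hi} \<Longrightarrow> y \<in> {lo..hi} \<Longrightarrow> \<bar>h x - h y\<bar> \<le> L * \<bar>x - y\<bar>"
proof -
  obtain L where L: "L > 0" "\<And>x. x \<in> {lo..hi} \<Longrightarrow> \<bar>h' x\<bar> \<le> L" using bounded_on_range[OF cont] by blast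
  have "\<bar>h x - h y\<bar> \<le> L * \<bar>x - y\<bar>" if "x \<in> {lo..hi}" "y \<in> {lo..hi}" for x y
  proof -
    have "norm (h x - h y) \<le> L * norm (x - y)"
    proof (rule field_differentiable_bound[of "{lo..hi}"])
      show "(h has_field_derivative h' z) (at z within {lo..hi})" if "z \<in> {lo..hi}" for z
        using der[of z] that lo by (auto intro: has_field_derivative_at_within)
    qed (use L that in auto)
    then show ?thesis by simp
  qed
  then show ?thesis using that L by blast
qed

text \<open>At a common zero of \<open>a\<close> and \<open>b\<close> the derivative of
  \<open>r\<close> vanishes whatever \<open>s\<close> is, so the ray is invariant. Orbits cannot
  enter or leave it by a Gronwall estimate for the squared distance \<open>N\<close>, using that
  \<open>a\<close> and \<open>b\<close> are Lipschitz and \<open>s > 1\<close>.\<close>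

lemma constant_of_common_zero:
  assumes x: "x \<in> {lo..hi}" "a x = 0" "b x = 0" and t0: "t0 > 0" "r t0 = x" and t: "t > 0"
  shows "r t = x"
proof -
  have "continuous_on {0<..} (\<lambda>x. (1 + x\<^sup>2) * g x - A2 x)" "continuous_on {0<..} (\<lambda>x. (x + x\<^sup>2) * g x - 2 * x * B2 x)"
    by (intro continuous_intros g_cont A2_cont B2_cont)+
  note lip = lipschitz_on_range[OF a_deriv this(1)] lipschitz_on_range[OF b_deriv this(2)]
  obtain La where La: "La > 0" "\<And>y z. y \<in> {lo..hi} \<Longrightarrow> z \<in> {lo..hi} \<Longrightarrow> \<bar>a y - a z\<bar> \<le> La * \<bar>y - z\<bar>"
    using lip(1) by blast
  obtain Lb where Lb: "Lb > 0" "\<And>y z. y \<in> {lo..hi} \<Longrightarrow> z \<in> {lo..hi} \<Longrightarrow> \<bar>b y - b z\<bar> \<le> Lb * \<bar>y - z\<bar>"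
    using lip(2) by blast
  define L where "L = La + Lb"
  define N where "N t = (r t - x)\<^sup>2" for t
  define N' where "N' t = 2 * (r t - x) * ((a (r t) - b (r t) * s t) / s t)" for t
  have N: "(N has_real_derivative N' t) (at t)" if "t > 0" for t
    unfolding N_def[abs_def] N'_def using r_deriv[OF that] by (auto intro!: derivative_eq_intros)
  have N': "\<bar>N' t\<bar> \<le> 2 * L * N t" if "t > 0" for t
  proof -
    have s: "s t > 1" using s_bounds[OF that] by simp
    have "\<bar>(a (r t) - b (r t) * s t) / s t\<bar> = \<bar>a (r t) / s t - b (r t)\<bar>" using s by (simp add: diff_divide_distrib)
    also have "\<dots> \<le> \<bar>a (r t) / s t\<bar> + \<bar>b (r t)\<bar>" by linarith
    also have "\<bar>a (r t) / s t\<bar> \<le> \<bar>a (r t)\<bar>"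
      using s by (rule abs_divide_le)
    also have "\<bar>a (r t)\<bar> + \<bar>b (r t)\<bar> \<le> L * \<bar>r t - x\<bar>"
      using La(2)[OF r_bounds[OF that] x(1)] Lb(2)[OF r_bounds[OF that] x(1)] x by (simp add: L_def algebra_simps)
    finally have "\<bar>(a (r t) - b (r t) * s t) / s t\<bar> \<le> L * \<bar>r t - x\<bar>" by simp
    then have "\<bar>2 * (r t - x)\<bar> * \<bar>(a (r t) - b (r t) * s t) / s t\<bar> \<le> \<bar>2 * (r t - x)\<bar> * (L * \<bar>r t - x\<bar>)"
      by (rule mult_left_mono) simp
    also have "\<dots> = 2 * L * \<bar>r t - x\<bar>\<^sup>2" unfolding abs_mult power2_eq_square by simp
    also have "\<dots> = 2 * L * N t" by (simp add: N_def)
    finally show ?thesis by (simp add: N'_def abs_mult)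
  qed
  have "N t0 = 0" by (simp add: N_def t0)
  have "N t \<le> 0"
  \<comment> \<open>The two-sided bound on \<open>N'\<close> allows Gronwall in both time
    directions: an exponentially weighted \<open>N\<close> decreases after \<open>t0\<close> and,
    with the opposite weight, increases before \<open>t0\<close>.\<close>
  proof (cases "t0 \<le> t")
    case True
    have "N t * exp (- (2 * L * t)) \<le> N t0 * exp (- (2 * L * t0))"
    proof (rule DERIV_nonpos_imp_nonincreasing[OF True, where f = "\<lambda>t. N t * exp (- (2 * L * t))"])
      fix u assume u: "t0 \<le> u" "u \<le> t"
      have "((\<lambda>t. N t * exp (- (2 * L * t))) has_real_derivative (N' u - 2 * L * N u) * exp (- (2 * L * u))) (at u)"
        using N[of u] u t0 by (auto intro!: derivative_eq_intros simp: algebra_simps)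
      moreover have "(N' u - 2 * L * N u) * exp (- (2 * L * u)) \<le> 0"
        using N'[of u] u t0 by (intro mult_nonpos_nonneg) auto
      ultimately show "\<exists>y. ((\<lambda>t. N t * exp (- (2 * L * t))) has_real_derivative y) (at u) \<and> y \<le> 0" by blast
    qed
    then show ?thesis using \<open>N t0 = 0\<close> by (simp add: mult_le_0_iff)
  next
    case False
    have "N t * exp (2 * L * t) \<le> N t0 * exp (2 * L * t0)"
    proof (rule DERIV_nonneg_imp_nondecreasing[where f = "\<lambda>t. N t * exp (2 * L * t)"])
      fix u assume u: "t \<le> u" "u \<le> t0"
      have "((\<lambda>t. N t * exp (2 * L * t)) has_real_derivative (N' u + 2 * L * N u) * exp (2 * L * u)) (at u)"
        using N[of u] u t by (auto intro!: derivative_eq_intros simp: algebra_simps)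
      moreover have "(N' u + 2 * L * N u) * exp (2 * L * u) \<ge> 0"
        using N'[of u] u t by (intro mult_nonneg_nonneg) auto
      ultimately show "\<exists>y. ((\<lambda>t. N t * exp (2 * L * t)) has_real_derivative y) (at u) \<and> y \<ge> 0" by blast
    qed (use False in simp)
    then show ?thesis using \<open>N t0 = 0\<close> by (simp add: mult_le_0_iff)
  qed
  then show ?thesis by (simp add: N_def)
qed

text \<open>The speed bound required by \<open>convergent_imp_avoids_pos_deriv\<close>: the orbit
  stays in a compact set, where the vector field is bounded.\<close>

lemma orbit_lipschitz:
  obtains V where "V > 0" "\<And>t t'. 0 < t \<Longrightarrow> t \<le> t' \<Longrightarrow> dist (r t, s t) (r t', s t') \<le> V * (t' - t)"
proof -
  obtain La where La: "La > 0" "\<And>x. x \<in> {lo..hi} \<Longrightarrow> \<bar>a x\<bar> \<le> La" using bounded_on_range[OF a_cont] by blast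
  obtain Lb where Lb: "Lb > 0" "\<And>x. x \<in> {lo..hi} \<Longrightarrow> \<bar>b x\<bar> \<le> Lb" using bounded_on_range[OF b_cont] by blast
  obtain LA where LA: "LA > 0" "\<And>x. x \<in> {lo..hi} \<Longrightarrow> \<bar>A2 x\<bar> \<le> LA" using bounded_on_range[OF A2_cont] by blast
  obtain LB where LB: "LB > 0" "\<And>x. x \<in> {lo..hi} \<Longrightarrow> \<bar>B2 x\<bar> \<le> LB" using bounded_on_range[OF B2_cont] by blast
  define V where "V = (La + Lb) + (LA + hi * C * LB)"
  have hi: "hi > 0" and C: "C > 0" using r_bounds[of 1] s_bounds[of 1] lo by auto
  have "dist (r t, s t) (r t', s t') \<le> V * (t' - t)" if "0 < t" "t \<le> t'" for t t'
  proof -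
    have "norm (r t - r t') \<le> (La + Lb) * norm (t - t')"
    proof (rule field_differentiable_bound[of "{0<..}" r])
      fix u :: real assume u: "u \<in> {0<..}"
      show "(r has_field_derivative (a (r u) - b (r u) * s u) / s u) (at u within {0<..})"
        using r_deriv[of u] u by (auto intro: has_field_derivative_at_within)
      have s: "s u > 1" using s_bounds[of u] u by simp
      have "norm ((a (r u) - b (r u) * s u) / s u) = \<bar>a (r u) / s u - b (r u)\<bar>" using s by (simp add: diff_divide_distrib)
      also have "\<dots> \<le> \<bar>a (r u) / s u\<bar> + \<bar>b (r u)\<bar>" by linarith
      also have "\<bar>a (r u) / s u\<bar> \<le> \<bar>a (r u)\<bar>"
        using s by (rule abs_divide_le)
      also have "\<bar>a (r u)\<bar> + \<bar>b (r u)\<bar> \<le> La + Lb" using La Lb r_bounds[of u] u by (intro add_mono) auto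
      finally show "norm ((a (r u) - b (r u) * s u) / s u) \<le> La + Lb" by simp
    qed (use that in auto)
    moreover have "norm (s t - s t') \<le> (LA + hi * C * LB) * norm (t - t')"
    proof (rule field_differentiable_bound[of "{0<..}" s])
      fix u :: real assume u: "u \<in> {0<..}"
      show "(s has_field_derivative A2 (r u) - r u * s u * B2 (r u)) (at u within {0<..})"
        using s_deriv[of u] u by (auto intro: has_field_derivative_at_within)
      have "norm (A2 (r u) - r u * s u * B2 (r u)) \<le> \<bar>A2 (r u)\<bar> + \<bar>r u\<bar> * \<bar>s u\<bar> * \<bar>B2 (r u)\<bar>"
        unfolding abs_mult[symmetric] by simp
      also have "\<dots> \<le> LA + hi * C * LB"
        using r_bounds[of u] s_bounds[of u] u lo LA LB hi C by (intro add_mono mult_mono) auto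
      finally show "norm (A2 (r u) - r u * s u * B2 (r u)) \<le> LA + hi * C * LB" .
    qed (use that in auto)
    moreover have "dist (r t, s t) (r t', s t') \<le> norm (r t - r t') + norm (s t - s t')"
      using sqrt_sum_squares_le_sum_abs[of "r t - r t'" "s t - s t'"] by (simp add: dist_Pair_Pair dist_real_def)
    ultimately show ?thesis using that by (simp add: V_def algebra_simps)
  qed
  moreover have "V > 0" using La Lb LA LB hi C by (simp add: V_def add_pos_pos)
  ultimately show ?thesis using that by blast
qed

end

section \<open>Sign of the divergence where both multipliers exceed 1\<close>

context ratio_flow
begin

text \<open>In the multiplier coordinates the divergence at \<open>(r, s) = (x, y)\<close> is
  \<open>g x * (1 + x\<^sup>2 - y * (x + x\<^sup>2)) / y\<close>. The inequality makes it
  nonpositive on the boundary curve \<open>y = \<tau> x\<close>, hence negative beyond.\<close>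

lemma \<tau>_bound: "x > 0 \<Longrightarrow> 1 + x\<^sup>2 \<le> \<tau> x * (x + x\<^sup>2)"
proof (cases "x \<ge> 1")
  case True
  assume "x > 0"
  then have "\<tau> x = 1" using True by (simp add: \<tau>_def)
  then show ?thesis using True by simp
next
  case False
  assume x: "x > 0"
  then have "\<tau> x = 1 / x" using False by (simp add: \<tau>_def max_def)
  then have "\<tau> x * (x + x\<^sup>2) = 1 + x" using x by (simp add: field_simps power2_eq_square)
  moreover have "x\<^sup>2 \<le> x" using False x by (simp add: power2_eq_square)
  ultimately show ?thesis by simp
qed

text \<open>Integrating the affine factor of the divergence in the second coordinate from
  \<open>y\<close> to \<open>S\<close> evaluates it at the mean of the two, so this mean decides the
  sign of the Lyapunov derivative.\<close>

lemma mean_gt: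
  assumes "x > 0" "\<tau> x \<le> S" "\<tau> x \<le> y" "\<tau> x < S \<or> \<tau> x < y"
  shows "1 + x\<^sup>2 < (S + y) * (x + x\<^sup>2) / 2"
proof -
  have p: "x + x\<^sup>2 > 0" using assms by (simp add: add_pos_pos)
  have "1 + x\<^sup>2 \<le> \<tau> x * (x + x\<^sup>2)" using \<tau>_bound assms by blast
  also have "\<dots> < ((S + y) / 2) * (x + x\<^sup>2)" using p assms by (intro mult_strict_right_mono) auto
  finally show ?thesis by simp
qed

end

section \<open>The strip swept by an oscillating ratio\<close>

locale oscillating_ratio_flow = ratio_flow +
  fixes r1 r2 :: real
  assumes r12: "r1 < r2"
    and ev_gt: "\<And>x. x < r1 \<Longrightarrow> \<forall>\<^sub>F t in at_top. x < r t"
    and ev_lt: "\<And>x. x > r2 \<Longrightarrow> \<forall>\<^sub>F t in at_top. r t < x"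
    and freq_lt: "\<And>x. x > r1 \<Longrightarrow> \<exists>\<^sub>F t in at_top. r t < x"
    and freq_gt: "\<And>x. x < r2 \<Longrightarrow> \<exists>\<^sub>F t in at_top. x < r t"
begin

lemma lo_le_r1: "lo \<le> r1" and r2_le_hi: "r2 \<le> hi"
proof -
  show "lo \<le> r1"
  proof (rule ccontr)
    assume "\<not> lo \<le> r1"
    then have "\<exists>\<^sub>F t in at_top. r t < lo" by (intro freq_lt) simp
    then obtain t where "t > 0" "r t < lo" by (rule frequently_at_top_real_obtain)
    then show False using r_bounds by force
  qed
  show "r2 \<le> hi"
  proof (rule ccontr)
    assume "\<not> r2 \<le> hi"
    then have "\<exists>\<^sub>F t in at_top. hi < r t" by (intro freq_gt) simp
    then obtain t where "t > 0" "hi < r t" by (rule frequently_at_top_real_obtain)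
    then show False using r_bounds by force
  qed
qed

lemma r1_pos: "r1 > 0" using lo lo_le_r1 by simp

lemma upcrossing:
  assumes "r1 < p" "p < q" "q < r2" "T > 0"
  obtains t t' where "T < t" "t < t'" "r t = p" "r t' = q" "\<And>u. u \<in> {t..t'} \<Longrightarrow> r u \<in> {p..q}"
proof -
  obtain u where u: "u > T" "r u < p" using frequently_at_top_real_obtain[OF freq_lt[OF assms(1)]] .
  obtain v where v: "v > u" "q < r v" using frequently_at_top_real_obtain[OF freq_gt[OF assms(3)]] .
  have "continuous_on {u..v} r"
    using u assms by (intro continuous_at_imp_continuous_on ballI r_isCont) auto
  then obtain t t' where "u \<le> t" "t < t'" "t' \<le> v" "r t = p" "r t' = q" "\<And>w. w \<in> {t..t'} \<Longrightarrow> r w \<in> {p..q}"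
    using strip_crossing_times[of u v r p q] u v assms by auto
  then show ?thesis using that[of t t'] u by auto
qed

lemma hits:
  assumes "r1 < x" "x < r2"
  shows "\<exists>\<^sub>F t in at_top. r t = x"
proof (rule ccontr)
  assume "\<not> (\<exists>\<^sub>F t in at_top. r t = x)"
  then have "\<forall>\<^sub>F t in at_top. r t \<noteq> x" by (simp add: not_frequently)
  then obtain T where T: "\<And>t. t \<ge> T \<Longrightarrow> r t \<noteq> x" by (auto simp: eventually_at_top_linorder)
  obtain q where q: "x < q" "q < r2" using dense[OF assms(2)] by auto
  have "0 < max T 1" by simp
  then obtain t t' where "max T 1 < t" "r t = x" using upcrossing[OF assms(1) q] by metis
  then show False using T[of t] by auto
qed

text \<open>On a passage from below to above \<open>x\<close> the derivative of \<open>r\<close> is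
  nonnegative at some crossing; multiplying by \<open>s > 0\<close> leaves the sign of
  \<open>a x - b x * s t\<close>.\<close>

lemma hit_up:
  assumes "r1 < x" "x < r2"
  obtains t where "t > 0" "r t = x" "a x - b x * s t \<ge> 0"
proof -
  obtain u where u: "u > 0" "r u < x" using frequently_at_top_real_obtain[OF freq_lt[OF assms(1)]] .
  obtain v where v: "v > u" "x < r v" using frequently_at_top_real_obtain[OF freq_gt[OF assms(2)]] .
  obtain t where "t \<in> {u..v}" "r t = x" "(a (r t) - b (r t) * s t) / s t \<ge> 0"
    using level_time_deriv_nonneg[of u v r x "\<lambda>t. (a (r t) - b (r t) * s t) / s t"] u v r_deriv by auto
  then show ?thesis using that[of t] s_bounds[of t] u by (auto simp: zero_le_divide_iff)
qed

lemma hit_down: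
  assumes "r1 < x" "x < r2"
  obtains t where "t > 0" "r t = x" "a x - b x * s t \<le> 0"
proof -
  obtain u where u: "u > 0" "x < r u" using frequently_at_top_real_obtain[OF freq_gt[OF assms(2)]] .
  obtain v where v: "v > u" "r v < x" using frequently_at_top_real_obtain[OF freq_lt[OF assms(1)]] .
  have "((\<lambda>t. - r t) has_real_derivative - ((a (r t) - b (r t) * s t) / s t)) (at t)" if "t > 0" for t
    using r_deriv[OF that] by (rule DERIV_minus)
  then obtain t where "t \<in> {u..v}" "- r t = - x" "- ((a (r t) - b (r t) * s t) / s t) \<ge> 0"
    using level_time_deriv_nonneg[of u v "\<lambda>t. - r t" "- x" "\<lambda>t. - ((a (r t) - b (r t) * s t) / s t)"] u v by auto
  then show ?thesis using that[of t] s_bounds[of t] u by (auto simp: divide_le_0_iff)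
qed

lemma no_common_zero_hit:
  assumes "x \<in> {lo..hi}" "a x = 0" "b x = 0" "t > 0"
  shows "r t \<noteq> x"
proof
  assume "r t = x"
  then have const: "r u = x" if "u > 0" for u using constant_of_common_zero[OF assms(1-3,4)] that by simp
  obtain q where q: "r1 < q" "q < r2" using dense[OF r12] by auto
  obtain p where p: "r1 < p" "p < q" using dense[OF q(1)] by auto
  obtain u u' where "1 < u" "u < u'" "r u = p" "r u' = q" using upcrossing[OF p q(2) zero_less_one] .
  then show False using const[of u] const[of u'] \<open>p < q\<close> by simp
qed

text \<open>Each ray in the strip is met with both signs of \<open>a x - b x * s\<close>. If
  \<open>b x\<close> vanished, so would \<open>a x\<close>, and the ray would be invariant.
  Otherwise \<open>\<sigma> x\<close> lies between two values that \<open>s\<close> attains on the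
  ray, so it inherits the bounds valid along the orbit.\<close>

lemma strip_bounds:
  assumes x: "r1 < x" "x < r2"
  shows "b x \<noteq> 0" "\<tau> x < \<sigma> x" "\<sigma> x \<le> C"
proof -
  obtain t where t: "t > 0" "r t = x" "a x - b x * s t \<ge> 0" using hit_up[OF x] .
  obtain u where u: "u > 0" "r u = x" "a x - b x * s u \<le> 0" using hit_down[OF x] .
  show b: "b x \<noteq> 0"
  proof
    assume b: "b x = 0"
    then have "a x = 0" using t u by simp
    moreover have "x \<in> {lo..hi}" using r_bounds t by blast
    ultimately show False using no_common_zero_hit b t by blast
  qed
  have "min (s t) (s u) \<le> \<sigma> x \<and> \<sigma> x \<le> max (s t) (s u)"
  proof (cases "b x > 0")
    case True
    then have "s t \<le> \<sigma> x" "\<sigma> x \<le> s u" using t u by (auto simp: \<sigma>_def field_simps)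
    then show ?thesis by auto
  next
    case False
    then have "b x < 0" using b by simp
    then have "\<sigma> x \<le> s t" "s u \<le> \<sigma> x" using t u by (auto simp: \<sigma>_def field_simps)
    then show ?thesis by auto
  qed
  then show "\<tau> x < \<sigma> x" "\<sigma> x \<le> C"
    using s_gt_\<tau>[of t] s_gt_\<tau>[of u] s_bounds[of t] s_bounds[of u] t u by (auto simp: min_def max_def split: if_splits)
qed

text \<open>Inside the strip \<open>\<bar>\<sigma>\<bar> \<le> C\<close> means
  \<open>\<bar>a\<bar> \<le> C * \<bar>b\<bar>\<close>, a closed condition that extends to the
  endpoints, where \<sigma> itself may be undefined.\<close>

lemma endpoint_cases:
  assumes "x \<in> {r1..r2}"
  shows "b x \<noteq> 0 \<or> (a x = 0 \<and> b x = 0)"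
proof -
  have cl: "closure {r1<..<r2} = {r1..r2}" using r12 by simp
  have "\<bar>a x\<bar> - C * \<bar>b x\<bar> \<le> 0"
  proof (rule continuous_le_on_closure[of "{r1<..<r2}" "\<lambda>x. \<bar>a x\<bar> - C * \<bar>b x\<bar>"])
    show "continuous_on (closure {r1<..<r2}) (\<lambda>x. \<bar>a x\<bar> - C * \<bar>b x\<bar>)"
      unfolding cl using r1_pos
      by (intro continuous_intros continuous_on_subset[OF a_cont] continuous_on_subset[OF b_cont]) auto
    show "x \<in> closure {r1<..<r2}" using assms cl by simp
    fix y assume "y \<in> {r1<..<r2}"
    then have y: "b y \<noteq> 0" "\<tau> y < \<sigma> y" "\<sigma> y \<le> C" using strip_bounds[of y] by auto
    then have "\<bar>\<sigma> y\<bar> \<le> C" by (simp add: \<tau>_def)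
    then show "\<bar>a y\<bar> - C * \<bar>b y\<bar> \<le> 0" using y(1) by (simp add: \<sigma>_def abs_divide divide_le_eq)
  qed
  then show ?thesis by auto
qed

text \<open>If \<open>b\<close> vanishes at an endpoint, so does \<open>a\<close>; the corresponding ray is then invariant, so
  the orbit never reaches it and the interval may stop there.\<close>

lemma working_interval:
  obtains \<alpha> \<beta> where "0 < \<alpha>" "\<alpha> \<le> r1" "r2 \<le> \<beta>" "\<And>x. x \<in> {\<alpha><..<\<beta>} \<Longrightarrow> b x \<noteq> 0"
    "\<forall>\<^sub>F t in at_top. r t \<in> {\<alpha><..<\<beta>}"
proof -
  have nz_near: "\<exists>d>0. \<forall>y. dist y x < d \<longrightarrow> b y \<noteq> 0" if "x > 0" "b x \<noteq> 0" for x
    using continuous_at_avoid[OF isCont_coeffs(2)[OF that(1)] that(2)] by (auto simp: dist_commute)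
  have no_hit: "\<forall>t>0. r t \<noteq> x" if "x \<in> {r1..r2}" "b x = 0" for x
    using endpoint_cases[OF that(1)] no_common_zero_hit[of x] that lo_le_r1 r2_le_hi by auto
  obtain \<beta> where \<beta>: "r2 \<le> \<beta>" "\<And>x. x \<in> {r2..<\<beta>} \<Longrightarrow> b x \<noteq> 0" "\<forall>\<^sub>F t in at_top. r t < \<beta>"
  proof (cases "b r2 = 0")
    case True
    obtain T where T: "T > 0" "r T < r2" using frequently_at_top_real_obtain[OF freq_lt[OF r12]] .
    have "r t < r2" if tT: "t \<ge> T" for t
    proof (rule ccontr)
      assume "\<not> r t < r2"
      moreover have "continuous_on {T..t} r"
        using T by (intro continuous_at_imp_continuous_on ballI r_isCont) auto
      ultimately obtain u where "T \<le> u" "r u = r2" using IVT'[of r T r2 t] T tT by auto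
      then show False using no_hit[of r2] True T r12 by auto
    qed
    then have "\<forall>\<^sub>F t in at_top. r t < r2" unfolding eventually_at_top_linorder by blast
    then show ?thesis using that[of r2] by simp
  next
    case False
    then obtain d where d: "d > 0" "\<And>y. dist y r2 < d \<Longrightarrow> b y \<noteq> 0" using nz_near[of r2] r1_pos r12 by auto
    show ?thesis
    proof (rule that[of "r2 + d"])
      show "b x \<noteq> 0" if "x \<in> {r2..<r2 + d}" for x using d(2)[of x] that by (auto simp: dist_real_def)
      show "\<forall>\<^sub>F t in at_top. r t < r2 + d" using d by (intro ev_lt) simp
    qed (use d in simp)
  qed
  obtain \<alpha> where \<alpha>: "0 < \<alpha>" "\<alpha> \<le> r1" "\<And>x. x \<in> {\<alpha><..r1} \<Longrightarrow> b x \<noteq> 0" "\<forall>\<^sub>F t in at_top. \<alpha> < r t"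
  proof (cases "b r1 = 0")
    case True
    obtain T where T: "T > 0" "r1 < r T" using frequently_at_top_real_obtain[OF freq_gt[OF r12]] .
    have "r1 < r t" if tT: "t \<ge> T" for t
    proof (rule ccontr)
      assume "\<not> r1 < r t"
      moreover have "continuous_on {T..t} r"
        using T by (intro continuous_at_imp_continuous_on ballI r_isCont) auto
      ultimately obtain u where "T \<le> u" "r u = r1" using IVT2'[of r t r1 T] T tT by auto
      then show False using no_hit[of r1] True T r12 by auto
    qed
    then have "\<forall>\<^sub>F t in at_top. r1 < r t" unfolding eventually_at_top_linorder by blast
    then show ?thesis using that[of r1] r1_pos by simp
  next
    case False
    then obtain d where d: "d > 0" "\<And>y. dist y r1 < d \<Longrightarrow> b y \<noteq> 0" using nz_near[of r1] r1_pos by auto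
    show ?thesis
    \<comment> \<open>The bound \<open>r1 / 2\<close> keeps the left endpoint positive even when
      \<open>d\<close> is large.\<close>
    proof (rule that[of "max (r1 - d) (r1 / 2)"])
      show "b x \<noteq> 0" if "x \<in> {max (r1 - d) (r1 / 2)<..r1}" for x using d(2)[of x] that by (auto simp: dist_real_def)
      show "\<forall>\<^sub>F t in at_top. max (r1 - d) (r1 / 2) < r t" using d r1_pos by (intro ev_gt) simp
    qed (use d r1_pos in auto)
  qed
  show ?thesis
  proof (rule that[of \<alpha> \<beta>])
    fix x assume "x \<in> {\<alpha><..<\<beta>}"
    then consider "x \<in> {\<alpha><..r1}" | "x \<in> {r1<..<r2}" | "x \<in> {r2..<\<beta>}" by fastforce
    then show "b x \<noteq> 0" using \<alpha> \<beta> strip_bounds(1)[of x] by cases auto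
  qed (use \<alpha> \<beta> eventually_conj[OF \<alpha>(4) \<beta>(3)] in auto)
qed

end

text \<open>The capitals stand for the coefficients at \<open>x\<close>: \<open>A\<close>,
  \<open>B\<close>, \<open>G\<close>, \<open>P\<close>, \<open>Q\<close> for \<open>a\<close>,
  \<open>b\<close>, \<open>g\<close>, \<open>A2\<close>, \<open>B2\<close>, while \<open>R\<close>
  is the speed of the ratio and \<open>y\<close> the value of \<open>s\<close>. By the hypothesis
  all terms with \<open>P\<close> and \<open>Q\<close> cancel; what remains is a difference of the
  same quadratic at \<open>y\<close> and at \<open>S\<close>, hence the factor
  \<open>S - y\<close>.\<close>

lemma lyapunov_derivative_identity:
  fixes A B G P Q R S x y :: real
  assumes "R * y = A - B * y"
  shows "((1 + x\<^sup>2) * G - P) * R * y + A * (P - x * y * Q)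
      - (((x + x\<^sup>2) * G - 2 * x * Q) * R * y\<^sup>2 / 2 + B * y * (P - x * y * Q))
      - G * (S * (1 + x\<^sup>2) - S\<^sup>2 * (x + x\<^sup>2) / 2) * R
    = R * G * (S - y) * ((S + y) * (x + x\<^sup>2) / 2 - (1 + x\<^sup>2))"
proof -
  have "A = R * y + B * y" using assms by simp
  then show ?thesis by (simp add: field_simps power2_eq_square)
qed

section \<open>The Lyapunov function and limits along a ray\<close>

context oscillating_ratio_flow
begin

lemma strip_pos: "r1 < x \<Longrightarrow> x > 0" using r1_pos by simp

text \<open>Limits along this filter are limits over the late times at which the orbit meets the ray
  \<open>r = x\<close>. It is proper for \<open>x\<close> in the strip, so such limits are
  unique.\<close>

definition hit_filter :: "real \<Rightarrow> real filter" where
  "hit_filter x = inf at_top (principal {t. r t = x})"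

lemma eventually_hit_filter: "eventually P (hit_filter x) \<longleftrightarrow> (\<forall>\<^sub>F t in at_top. r t = x \<longrightarrow> P t)"
  by (simp add: hit_filter_def eventually_inf_principal)

lemma hit_filter_ne_bot: "r1 < x \<Longrightarrow> x < r2 \<Longrightarrow> hit_filter x \<noteq> bot"
  using hits[of x] by (simp add: trivial_limit_def eventually_hit_filter frequently_def)

text \<open>In the coordinates \<open>(m1, m2)\<close> the vector field has negative divergence. The area form
  \<open>dm1 dm2 = s dr ds\<close> turns this into an energy: \<open>b s^2 / 2 - a s\<close> has \<open>s\<close>-derivative
  \<open>- s r'\<close>, and the correction \<open>W\<close> is chosen such that the remaining terms of the total derivative
  cancel on the curve \<open>s = \<sigma> r\<close>. Replacing \<open>\<sigma>\<close> by \<open>max \<sigma> \<tau>\<close> in \<open>W\<close> keeps the sign of the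
  derivative outside the strip, where \<open>\<sigma>\<close> need not exceed \<open>\<tau>\<close>.\<close>

lemma lyapunov:
  obtains e W k where "e \<noteq> 0"
    "\<And>x. r1 < x \<Longrightarrow> x < r2 \<Longrightarrow> (W has_real_derivative g x * (\<sigma> x * (1 + x\<^sup>2) - (\<sigma> x)\<^sup>2 * (x + x\<^sup>2) / 2)) (at x)"
    "((\<lambda>t. e * (a (r t) * s t - b (r t) * ((s t)\<^sup>2 / 2) - W (r t))) \<longlongrightarrow> k) at_top"
    "\<And>x. r1 < x \<Longrightarrow> x < r2 \<Longrightarrow> (s \<longlongrightarrow> \<sigma> x) (hit_filter x)"
proof -
  obtain \<alpha> \<beta> where \<alpha>: "0 < \<alpha>" "\<alpha> \<le> r1" "r2 \<le> \<beta>" and nz: "\<And>x. x \<in> {\<alpha><..<\<beta>} \<Longrightarrow> b x \<noteq> 0"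
    and ev: "\<forall>\<^sub>F t in at_top. r t \<in> {\<alpha><..<\<beta>}"
    using working_interval by blast
  define J where "J = {\<alpha><..<\<beta>}"
  have Jpos: "x > 0" if "x \<in> J" for x using that \<alpha> by (simp add: J_def)
  have J_sub: "J \<subseteq> {0<..}" using Jpos by auto
  have JI: "x \<in> J" if "r1 < x" "x < r2" for x using that \<alpha> by (simp add: J_def)
  note conts = continuous_on_subset[OF a_cont J_sub] continuous_on_subset[OF b_cont J_sub]
    continuous_on_subset[OF g_cont J_sub]
  obtain x0 where x0: "r1 < x0" "x0 < r2" using dense[OF r12] by auto
  \<comment> \<open>The energy increases or decreases according to the constant sign of
    \<open>b\<close>; the factor \<open>e\<close> makes it increase in both cases.\<close>
  define e where "e = sgn (b x0)"
  have e_b: "e * b x > 0" if "x \<in> J" for x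
  proof -
    have "sgn (b x0) = sgn (b x)"
      using same_sign_on_interval[OF conts(2)[unfolded J_def] nz, of x0 x] that JI[OF x0] by (simp add: J_def)
    then have "e * b x = \<bar>b x\<bar>" unfolding e_def by (simp add: abs_sgn mult.commute)
    then show ?thesis using nz[of x] that by (simp add: J_def)
  qed
  have e_ne: "e \<noteq> 0" using e_b[OF JI[OF x0]] by auto
  have e_abs: "\<bar>e\<bar> \<le> 1" unfolding e_def by (simp add: sgn_if)
  define S where "S x = max (\<sigma> x) (\<tau> x)" for x
  have \<sigma>_cont: "continuous_on J \<sigma>"
    unfolding \<sigma>_def[abs_def] using nz by (intro continuous_intros conts) (auto simp: J_def)
  have S_cont: "continuous_on J S"
    unfolding S_def[abs_def] \<tau>_def[abs_def] using Jpos
    by (intro continuous_intros \<sigma>_cont continuous_on_max) force+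
  have S_strip: "S x = \<sigma> x" if "r1 < x" "x < r2" for x using strip_bounds(2)[OF that] by (simp add: S_def)
  define W' where "W' x = g x * (S x * (1 + x\<^sup>2) - (S x)\<^sup>2 * (x + x\<^sup>2) / 2)" for x
  have "continuous_on J W'" unfolding W'_def[abs_def] by (intro continuous_intros conts S_cont) auto
  then obtain W where W: "\<And>x. x \<in> J \<Longrightarrow> (W has_real_derivative W' x) (at x)"
    using open_interval_antiderivative[of \<alpha> \<beta> W'] \<alpha> r12 unfolding J_def by auto
  \<comment> \<open>The derivative of \<open>K\<close> as a function of the point
    \<open>(r, s)\<close>, so that continuity at a limit point of the orbit can be used.\<close>
  define D where "D z = e * b (fst z) * g (fst z) / snd z * (\<sigma> (fst z) - snd z) * (S (fst z) - snd z)
    * ((S (fst z) + snd z) * (fst z + (fst z)\<^sup>2) / 2 - (1 + (fst z)\<^sup>2))" for z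
  define K where "K t = e * (a (r t) * s t - b (r t) * ((s t)\<^sup>2 / 2) - W (r t))" for t
  obtain T where T: "T > 0" "\<And>t. t \<ge> T \<Longrightarrow> r t \<in> J"
  proof -
    have "\<forall>\<^sub>F t in at_top. r t \<in> J \<and> t > 0" using ev eventually_gt_at_top[of 0] unfolding J_def by (rule eventually_conj)
    then obtain T where "\<And>t. t \<ge> T \<Longrightarrow> r t \<in> J \<and> t > 0" unfolding eventually_at_top_linorder by blast
    then show ?thesis using that[of T] by auto
  qed
  have K_deriv: "(K has_real_derivative D (r t, s t)) (at t)" if t: "t \<ge> T" for t
  proof -
    define x y where "x = r t" and "y = s t"
    have x: "x \<in> J" "x > 0" "b x \<noteq> 0" using T(2)[OF t] Jpos nz by (auto simp: x_def J_def)
    have y: "y > 0" using s_bounds[of t] t T by (simp add: y_def)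
    define R where "R = (a x - b x * y) / y"
    have dr: "(r has_real_derivative R) (at t)" using r_deriv[of t] t T by (simp add: R_def x_def y_def)
    have ds: "(s has_real_derivative A2 x - x * y * B2 x) (at t)" using s_deriv[of t] t T by (simp add: x_def y_def)
    have ds2: "((\<lambda>t. (s t)\<^sup>2 / 2) has_real_derivative y * (A2 x - x * y * B2 x)) (at t)"
      by (auto intro!: derivative_eq_intros ds simp: y_def)
    have da: "((\<lambda>t. a (r t)) has_real_derivative ((1 + x\<^sup>2) * g x - A2 x) * R) (at t)"
      using DERIV_chain2[OF a_deriv[of "r t"] dr] x by (simp add: x_def)
    have db: "((\<lambda>t. b (r t)) has_real_derivative ((x + x\<^sup>2) * g x - 2 * x * B2 x) * R) (at t)"
      using DERIV_chain2[OF b_deriv[of "r t"] dr] x by (simp add: x_def)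
    have dW: "((\<lambda>t. W (r t)) has_real_derivative W' x * R) (at t)"
      using DERIV_chain2[OF W[of "r t"] dr] x by (simp add: x_def)
    have "((\<lambda>t. a (r t) * s t - b (r t) * ((s t)\<^sup>2 / 2) - W (r t)) has_real_derivative
        ((1 + x\<^sup>2) * g x - A2 x) * R * y + a x * (A2 x - x * y * B2 x)
        - (((x + x\<^sup>2) * g x - 2 * x * B2 x) * R * y\<^sup>2 / 2 + b x * y * (A2 x - x * y * B2 x)) - W' x * R) (at t)"
      by (rule DERIV_cong[OF DERIV_diff[OF DERIV_diff[OF DERIV_mult[OF da ds] DERIV_mult[OF db ds2]] dW]])
        (simp add: x_def[symmetric] y_def[symmetric] field_simps)
    also have "((1 + x\<^sup>2) * g x - A2 x) * R * y + a x * (A2 x - x * y * B2 x)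
        - (((x + x\<^sup>2) * g x - 2 * x * B2 x) * R * y\<^sup>2 / 2 + b x * y * (A2 x - x * y * B2 x)) - W' x * R
      = R * g x * (S x - y) * ((S x + y) * (x + x\<^sup>2) / 2 - (1 + x\<^sup>2))"
      unfolding W'_def by (rule lyapunov_derivative_identity) (use y in \<open>simp add: R_def\<close>)
    finally have "(K has_real_derivative e * (R * g x * (S x - y) * ((S x + y) * (x + x\<^sup>2) / 2 - (1 + x\<^sup>2)))) (at t)"
      unfolding K_def[abs_def] by (rule DERIV_cmult)
    moreover have "R = b x * (\<sigma> x - y) / y" using x y by (simp add: R_def \<sigma>_def field_simps)
    ultimately show ?thesis by (simp add: D_def mult_ac flip: x_def y_def)
  qed
  have D_nonneg: "D (r t, s t) \<ge> 0" if t: "t \<ge> T" for t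
  proof -
    have x: "r t \<in> J" "r t > 0" using T(2)[OF t] Jpos by auto
    have y: "\<tau> (r t) < s t" using s_gt_\<tau>[of t] t T by simp
    have "s t > 0" using s_bounds[of t] t T by simp
    then have 1: "e * b (r t) * g (r t) / s t \<ge> 0" using e_b[OF x(1)] g_pos[OF x(2)] by simp
    \<comment> \<open>Where \<open>S\<close> is \<sigma> this is a square; where \<open>S\<close> is
      \<tau>, both factors are nonpositive because \<open>\<sigma> \<le> \<tau> < s\<close>.\<close>
    have 2: "(\<sigma> (r t) - s t) * (S (r t) - s t) \<ge> 0"
      using y by (auto simp: S_def max_def zero_le_mult_iff)
    have 3: "(S (r t) + s t) * (r t + (r t)\<^sup>2) / 2 - (1 + (r t)\<^sup>2) \<ge> 0"
      using mean_gt[of "r t" "S (r t)" "s t"] x y by (simp add: S_def)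
    have "e * b (r t) * g (r t) / s t * ((\<sigma> (r t) - s t) * (S (r t) - s t))
      * ((S (r t) + s t) * (r t + (r t)\<^sup>2) / 2 - (1 + (r t)\<^sup>2)) \<ge> 0"
      by (rule mult_nonneg_nonneg[OF mult_nonneg_nonneg[OF 1 2] 3])
    then show ?thesis by (simp add: D_def mult.assoc)
  qed
  have K_mono: "K t \<le> K t'" if "T \<le> t" "t \<le> t'" for t t'
    by (rule DERIV_nonneg_imp_nondecreasing[OF that(2)]) (use K_deriv D_nonneg that in \<open>meson order_trans\<close>)
  \<comment> \<open>\<open>W\<close> may be unbounded near the ends of the open interval, so
    \<open>K\<close> is bounded only at the times when the ratio equals \<open>x0\<close>.\<close>
  have "\<exists>\<^sub>F t in at_top. K t \<le> \<bar>a x0\<bar> * C + \<bar>b x0\<bar> * (C\<^sup>2 / 2) + \<bar>W x0\<bar>"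
  proof (rule frequently_elim1)
    show "\<exists>\<^sub>F t in at_top. r t = x0 \<and> t > 0"
      by (rule frequently_eventually_frequently[OF hits[OF x0] eventually_gt_at_top])
    fix t assume t: "r t = x0 \<and> t > 0"
    then have s: "0 \<le> s t" "s t \<le> C" using s_bounds[of t] by auto
    have "K t \<le> \<bar>e * (a x0 * s t - b x0 * ((s t)\<^sup>2 / 2) - W x0)\<bar>" using t by (simp add: K_def)
    also have "\<dots> \<le> 1 * \<bar>a x0 * s t - b x0 * ((s t)\<^sup>2 / 2) - W x0\<bar>"
      unfolding abs_mult by (rule mult_right_mono[OF e_abs]) simp
    also have "\<dots> \<le> \<bar>a x0 * s t\<bar> + \<bar>b x0 * ((s t)\<^sup>2 / 2)\<bar> + \<bar>W x0\<bar>"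
      unfolding mult_1 by (rule order_trans[OF abs_triangle_ineq4 add_right_mono[OF abs_triangle_ineq4]])
    also have "\<dots> = \<bar>a x0\<bar> * s t + \<bar>b x0\<bar> * ((s t)\<^sup>2 / 2) + \<bar>W x0\<bar>" using s by (simp add: abs_mult)
    also have "\<dots> \<le> \<bar>a x0\<bar> * C + \<bar>b x0\<bar> * (C\<^sup>2 / 2) + \<bar>W x0\<bar>"
      using s by (intro add_mono mult_left_mono divide_right_mono power_mono) auto
    finally show "K t \<le> \<bar>a x0\<bar> * C + \<bar>b x0\<bar> * (C\<^sup>2 / 2) + \<bar>W x0\<bar>" .
  qed
  then obtain k where k: "(K \<longlongrightarrow> k) at_top" using increasing_convergent_at_top[of T K] K_mono by blast
  obtain V where V: "V > 0" "\<And>t t'. 0 < t \<Longrightarrow> t \<le> t' \<Longrightarrow> dist (r t, s t) (r t', s t') \<le> V * (t' - t)"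
    using orbit_lipschitz by blast
  have s_lim: "(s \<longlongrightarrow> \<sigma> x) (hit_filter x)" if x: "r1 < x" "x < r2" for x
  proof (rule tendstoI)
    \<comment> \<open>If \<open>s\<close> were \<epsilon>-far from \<open>\<sigma> x\<close> at
      arbitrarily late hits, compactness would give a cluster point
      \<open>y \<noteq> \<sigma> x\<close>. There \<open>D\<close> is positive, so the orbit would
      eventually avoid a neighbourhood of \<open>(x, y)\<close>, a contradiction.\<close>
    fix \<epsilon> :: real assume \<epsilon>: "\<epsilon> > 0"
    define Y where "Y = {\<tau> x..C} \<inter> {y. \<epsilon> \<le> \<bar>y - \<sigma> x\<bar>}"
    define F where "F = filtermap s (inf (hit_filter x) (principal {t. \<epsilon> \<le> \<bar>s t - \<sigma> x\<bar>}))"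
    have "closed {y. \<epsilon> \<le> \<bar>y - \<sigma> x\<bar>}" by (intro closed_Collect_le continuous_intros)
    then have Y: "compact Y" unfolding Y_def by (intro compact_Int_closed) auto
    have "\<forall>\<^sub>F t in at_top. r t = x \<longrightarrow> \<epsilon> \<le> \<bar>s t - \<sigma> x\<bar> \<longrightarrow> s t \<in> Y"
      using eventually_gt_at_top[of 0]
    proof eventually_elim
      case (elim t)
      then show ?case using s_gt_\<tau>[of t] s_bounds[of t] by (auto simp: Y_def)
    qed
    then have F_Y: "\<forall>\<^sub>F y in F. y \<in> Y"
      unfolding F_def by (simp add: eventually_filtermap eventually_inf_principal eventually_hit_filter)
    have "F = bot"
    proof (rule ccontr)
      assume "F \<noteq> bot"
      then obtain y where y: "y \<in> Y" "inf (nhds y) F \<noteq> bot"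
        using Y F_Y unfolding compact_filter by blast
      have y1: "y > 0" "\<tau> x \<le> y" "y \<noteq> \<sigma> x" using y \<epsilon> by (auto simp: Y_def \<tau>_def)
      have xJ: "x \<in> J" "x > 0" using JI[OF x] strip_pos[OF x(1)] by auto
      have iso: "isCont h x" if "continuous_on J h" for h :: "real \<Rightarrow> real"
        using that xJ by (auto simp: J_def continuous_on_eq_continuous_at)
      have "isCont (\<lambda>z::real\<times>real. h (fst z)) (x, y)" if "continuous_on J h" for h :: "real \<Rightarrow> real"
        by (rule isCont_o2[where f = fst]) (use iso[OF that] in \<open>auto intro: continuous_intros\<close>)
      note this[OF conts(1)] this[OF conts(2)] this[OF conts(3)] this[OF \<sigma>_cont] this[OF S_cont]
      then have D_cont: "isCont D (x, y)"
        unfolding D_def[abs_def] using y1 by (intro continuous_intros) auto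
      have "D (x, y) = (e * b x) * g x / y * (\<sigma> x - y)\<^sup>2 * ((\<sigma> x + y) * (x + x\<^sup>2) / 2 - (1 + x\<^sup>2))"
        by (simp add: D_def S_strip[OF x] power2_eq_square)
      also have "\<dots> > 0"
      proof (rule mult_pos_pos[OF mult_pos_pos])
        show "0 < (e * b x) * g x / y" by (rule divide_pos_pos[OF mult_pos_pos[OF e_b[OF xJ(1)] g_pos[OF xJ(2)]] y1(1)])
        show "0 < (\<sigma> x - y)\<^sup>2" using y1 by simp
        show "0 < (\<sigma> x + y) * (x + x\<^sup>2) / 2 - (1 + x\<^sup>2)"
          using mean_gt[OF xJ(2), of "\<sigma> x" y] strip_bounds(2)[OF x] y1 by simp
      qed
      finally have D_pos: "D (x, y) > 0" .
      have "dist (r t, s t) (r t', s t') \<le> V * (t' - t)" if "T \<le> t" "t \<le> t'" for t t'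
        using V(2)[of t t'] T that by simp
      then obtain \<delta> where \<delta>: "\<delta> > 0" "\<forall>\<^sub>F t in at_top. dist (r t, s t) (x, y) \<ge> \<delta>"
        using convergent_imp_avoids_pos_deriv[OF k, of T D "\<lambda>t. (r t, s t)" V "(x, y)"] K_deriv V(1) D_cont D_pos by blast
      have "\<forall>\<^sub>F t in at_top. r t = x \<longrightarrow> \<epsilon> \<le> \<bar>s t - \<sigma> x\<bar> \<longrightarrow> dist (s t) y \<ge> \<delta>"
        using \<delta>(2) by eventually_elim (auto simp: dist_Pair_Pair)
      then have 1: "\<forall>\<^sub>F z in F. dist z y \<ge> \<delta>"
        unfolding F_def by (simp add: eventually_filtermap eventually_inf_principal eventually_hit_filter)
      have 2: "\<forall>\<^sub>F z in nhds y. dist z y < \<delta>" using \<delta>(1) by (auto simp: eventually_nhds_metric)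
      have "\<forall>\<^sub>F z in inf (nhds y) F. False"
        unfolding eventually_inf using 1 2 by (intro exI[of _ "\<lambda>z. dist z y < \<delta>"] exI[of _ "\<lambda>z. dist z y \<ge> \<delta>"]) auto
      then show False using y(2) by (simp add: trivial_limit_def)
    qed
    then have "\<forall>\<^sub>F t in hit_filter x. \<not> \<epsilon> \<le> \<bar>s t - \<sigma> x\<bar>"
      unfolding F_def by (simp add: trivial_limit_def eventually_filtermap eventually_inf_principal)
    then show "\<forall>\<^sub>F t in hit_filter x. dist (s t) (\<sigma> x) < \<epsilon>"
      by (rule eventually_mono) (simp add: dist_real_def)
  qed
  show ?thesis
  proof (rule that[OF e_ne _ k[unfolded K_def[abs_def]] s_lim])
    fix x assume x: "r1 < x" "x < r2"
    show "(W has_real_derivative g x * (\<sigma> x * (1 + x\<^sup>2) - (\<sigma> x)\<^sup>2 * (x + x\<^sup>2) / 2)) (at x)"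
      using W[OF JI[OF x]] by (simp add: W'_def S_strip[OF x])
  qed
qed

section \<open>Contradiction from persistent oscillation\<close>

lemma no_oscillation: False
proof -
  obtain e W k where e: "e \<noteq> 0"
    and W: "\<And>x. r1 < x \<Longrightarrow> x < r2 \<Longrightarrow> (W has_real_derivative g x * (\<sigma> x * (1 + x\<^sup>2) - (\<sigma> x)\<^sup>2 * (x + x\<^sup>2) / 2)) (at x)"
    and k: "((\<lambda>t. e * (a (r t) * s t - b (r t) * ((s t)\<^sup>2 / 2) - W (r t))) \<longlongrightarrow> k) at_top"
    and s_lim: "\<And>x. r1 < x \<Longrightarrow> x < r2 \<Longrightarrow> (s \<longlongrightarrow> \<sigma> x) (hit_filter x)"
    using lyapunov by blast
  have \<sigma>_pos: "\<sigma> x > 0" if "r1 < x" "x < r2" for x using strip_bounds(2)[OF that] by (simp add: \<tau>_def)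
  have b\<sigma>: "a x = b x * \<sigma> x" if "r1 < x" "x < r2" for x using strip_bounds(1)[OF that] by (simp add: \<sigma>_def)
  have \<sigma>_deriv: "(\<sigma> has_real_derivative
      (((1 + x\<^sup>2) * g x - A2 x) - \<sigma> x * ((x + x\<^sup>2) * g x - 2 * x * B2 x)) / b x) (at x)"
    if x: "r1 < x" "x < r2" for x
    unfolding \<sigma>_def[abs_def]
    by (rule DERIV_cong[OF DERIV_divide[OF a_deriv b_deriv]])
      (use strip_bounds(1)[OF x] strip_pos[OF x(1)] in \<open>auto simp: field_simps\<close>)
  \<comment> \<open>Along the hits of \<open>x\<close> the energy has two limits: \<open>k\<close>,
    and its value at the nullcline point \<open>(x, \<sigma> x)\<close>.\<close>
  have const: "e * (a x * \<sigma> x / 2 - W x) = k" if x: "r1 < x" "x < r2" for x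
  proof (rule tendsto_unique[OF hit_filter_ne_bot[OF x]])
    have "((\<lambda>t. e * (a x * s t - b x * ((s t)\<^sup>2 / 2) - W x)) \<longlongrightarrow> e * (a x * \<sigma> x - b x * ((\<sigma> x)\<^sup>2 / 2) - W x)) (hit_filter x)"
      by (intro tendsto_intros s_lim[OF x]) auto
    also have "a x * \<sigma> x - b x * ((\<sigma> x)\<^sup>2 / 2) = a x * \<sigma> x / 2"
      using b\<sigma>[OF x] by (simp add: power2_eq_square)
    finally show "((\<lambda>t. e * (a x * s t - b x * ((s t)\<^sup>2 / 2) - W x)) \<longlongrightarrow> e * (a x * \<sigma> x / 2 - W x)) (hit_filter x)" .
    have "((\<lambda>t. e * (a (r t) * s t - b (r t) * ((s t)\<^sup>2 / 2) - W (r t))) \<longlongrightarrow> k) (hit_filter x)"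
      by (rule tendsto_mono[OF _ k]) (simp add: hit_filter_def)
    then show "((\<lambda>t. e * (a x * s t - b x * ((s t)\<^sup>2 / 2) - W x)) \<longlongrightarrow> k) (hit_filter x)"
      by (rule Lim_transform_eventually) (simp add: eventually_hit_filter)
  qed
  \<comment> \<open>Differentiating the constant energy cancels every term with \<open>g\<close> and
    leaves \<open>\<sigma> x\<close> times the negative of the speed of \<open>s\<close> on the
    nullcline.\<close>
  have equil: "A2 x = \<sigma> x * x * B2 x" if x: "r1 < x" "x < r2" for x
  proof -
    let ?a = "(1 + x\<^sup>2) * g x - A2 x" and ?b = "(x + x\<^sup>2) * g x - 2 * x * B2 x"
    let ?W = "g x * (\<sigma> x * (1 + x\<^sup>2) - (\<sigma> x)\<^sup>2 * (x + x\<^sup>2) / 2)"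
    have "((\<lambda>x. a x * \<sigma> x / 2 - W x) has_real_derivative (?a * \<sigma> x + (?a - \<sigma> x * ?b) / b x * a x) / 2 - ?W) (at x)"
      by (intro DERIV_diff DERIV_cdivide DERIV_mult a_deriv \<sigma>_deriv W x strip_pos)
    then have "(?a * \<sigma> x + (?a - \<sigma> x * ?b) / b x * a x) / 2 - ?W = 0"
      by (rule has_real_derivative_const_on_open_unique[rotated 3, of _ _ _ "{r1<..<r2}" "k / e"])
        (use const e x in \<open>auto simp: field_simps\<close>)
    also have "(?a - \<sigma> x * ?b) / b x * a x = (?a - \<sigma> x * ?b) * \<sigma> x"
      using b\<sigma>[OF x] strip_bounds(1)[OF x] by simp
    also have "(?a * \<sigma> x + (?a - \<sigma> x * ?b) * \<sigma> x) / 2 - ?W = \<sigma> x * (\<sigma> x * x * B2 x - A2 x)"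
      by (simp add: field_simps power2_eq_square)
    finally show ?thesis using \<sigma>_pos[OF x] by simp
  qed
  \<comment> \<open>By \<open>equil\<close> both speeds carry the factor
    \<open>\<sigma> r - s\<close>: that of \<open>ln s\<close> is
    \<open>r * B2 r * (\<sigma> r - s) / s\<close> and that of \<open>r\<close> is
    \<open>b r * (\<sigma> r - s) / s\<close>. Their quotient depends on \<open>r\<close> alone and
    is integrated to \<open>R\<close>.\<close>
  have "continuous_on {r1<..<r2} (\<lambda>x. x * B2 x / b x)"
    using strip_bounds(1) strip_pos
    by (intro continuous_intros continuous_on_subset[OF B2_cont] continuous_on_subset[OF b_cont]) auto
  then obtain R where R: "\<And>x. x \<in> {r1<..<r2} \<Longrightarrow> (R has_real_derivative x * B2 x / b x) (at x)"
    using open_interval_antiderivative[OF r12] by blast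
  have crossing_inv: "ln (s t) - R (r t) = ln (s t') - R (r t')"
    if t: "0 < t" "t < t'" and strip_t: "\<And>u. u \<in> {t..t'} \<Longrightarrow> r1 < r u \<and> r u < r2" for t t'
  proof -
    have deriv: "((\<lambda>t. ln (s t) - R (r t)) has_real_derivative 0) (at u)" if u: "u \<in> {t..t'}" for u
    proof -
      have u0: "u > 0" and ru: "r1 < r u" "r u < r2" using u t strip_t by auto
      have su: "s u > 0" using s_bounds[OF u0] by simp
      have 1: "((\<lambda>t. ln (s t)) has_real_derivative inverse (s u) * (A2 (r u) - r u * s u * B2 (r u))) (at u)"
        by (rule DERIV_chain2[OF DERIV_ln[OF su] s_deriv[OF u0]])
      have 2: "((\<lambda>t. R (r t)) has_real_derivative r u * B2 (r u) / b (r u) * ((a (r u) - b (r u) * s u) / s u)) (at u)"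
        by (rule DERIV_chain2[OF R r_deriv[OF u0]]) (use ru in simp)
      have "inverse (s u) * (A2 (r u) - r u * s u * B2 (r u))
          - r u * B2 (r u) / b (r u) * ((a (r u) - b (r u) * s u) / s u) = 0"
        using su strip_bounds(1)[OF ru] equil[OF ru] b\<sigma>[OF ru] by (simp add: field_simps)
      then show ?thesis using DERIV_diff[OF 1 2] by simp
    qed
    have "ln (s t') - R (r t') = ln (s t) - R (r t)"
    proof (rule DERIV_isconst_end[OF t(2)])
      show "continuous_on {t..t'} (\<lambda>t. ln (s t) - R (r t))"
        using deriv by (intro continuous_at_imp_continuous_on ballI DERIV_isCont) blast
    qed (use deriv in auto)
    then show ?thesis ..
  qed
  have strip_inv: "ln (\<sigma> p) - R p = ln (\<sigma> q) - R q" if pq: "r1 < p" "p < q" "q < r2" for p q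
  proof (rule ccontr)
    assume "ln (\<sigma> p) - R p \<noteq> ln (\<sigma> q) - R q"
    \<comment> \<open>A crossing from \<open>p\<close> to \<open>q\<close> conserves
      \<open>ln s - R\<close>. At late times both ends are close to the nullcline, with errors below
      \<open>d\<close> each, too small in total to account for the discrepancy
      \<open>2 * d\<close>.\<close>
    define d where "d = \<bar>(ln (\<sigma> p) - R p) - (ln (\<sigma> q) - R q)\<bar> / 2"
    have d: "d > 0" using \<open>ln (\<sigma> p) - R p \<noteq> _\<close> by (simp add: d_def)
    have near: "\<forall>\<^sub>F t in at_top. r t = x \<longrightarrow> \<bar>ln (s t) - ln (\<sigma> x)\<bar> < d" if x: "r1 < x" "x < r2" for x
    proof -
      have "((\<lambda>t. ln (s t)) \<longlongrightarrow> ln (\<sigma> x)) (hit_filter x)"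
        using \<sigma>_pos[OF x] by (intro tendsto_intros s_lim[OF x]) auto
      then show ?thesis using tendstoD[OF _ d] by (fastforce simp: eventually_hit_filter dist_real_def)
    qed
    have "\<forall>\<^sub>F t in at_top. (r t = p \<longrightarrow> \<bar>ln (s t) - ln (\<sigma> p)\<bar> < d) \<and> (r t = q \<longrightarrow> \<bar>ln (s t) - ln (\<sigma> q)\<bar> < d)"
      using pq by (intro eventually_conj near) auto
    then obtain T where T: "\<And>t. t \<ge> T \<Longrightarrow> (r t = p \<longrightarrow> \<bar>ln (s t) - ln (\<sigma> p)\<bar> < d) \<and> (r t = q \<longrightarrow> \<bar>ln (s t) - ln (\<sigma> q)\<bar> < d)"
      unfolding eventually_at_top_linorder by blast
    have "0 < max T 1" by simp
    then obtain t t' where t: "max T 1 < t" "t < t'" "r t = p" "r t' = q" "\<And>u. u \<in> {t..t'} \<Longrightarrow> r u \<in> {p..q}"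
      using upcrossing[OF pq] by metis
    have "r1 < r u \<and> r u < r2" if "u \<in> {t..t'}" for u using t(5)[OF that] pq by auto
    then have "ln (s t) - R p = ln (s t') - R q" using crossing_inv[of t t'] t by auto
    then have "(ln (\<sigma> p) - R p) - (ln (\<sigma> q) - R q) = (ln (s t') - ln (\<sigma> q)) - (ln (s t) - ln (\<sigma> p))" by simp
    then have "2 * d \<le> \<bar>ln (s t') - ln (\<sigma> q)\<bar> + \<bar>ln (s t) - ln (\<sigma> p)\<bar>" unfolding d_def using abs_triangle_ineq4 by simp
    moreover have "\<bar>ln (s t) - ln (\<sigma> p)\<bar> < d" "\<bar>ln (s t') - ln (\<sigma> q)\<bar> < d"
      using T[of t] T[of t'] t by auto
    ultimately show False by linarith
  qed
  obtain x where x: "r1 < x" "x < r2" using dense[OF r12] by auto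
  note xb = strip_bounds(1)[OF x] and x\<sigma> = \<sigma>_pos[OF x]
  let ?D = "(((1 + x\<^sup>2) * g x - A2 x) - \<sigma> x * ((x + x\<^sup>2) * g x - 2 * x * B2 x)) / b x"
  have "((\<lambda>x. ln (\<sigma> x)) has_real_derivative inverse (\<sigma> x) * ?D) (at x)"
    by (rule DERIV_chain2[OF DERIV_ln[OF x\<sigma>] \<sigma>_deriv[OF x]])
  then have "((\<lambda>x. ln (\<sigma> x) - R x) has_real_derivative inverse (\<sigma> x) * ?D - x * B2 x / b x) (at x)"
    by (rule DERIV_diff) (use R x in simp)
  then have "inverse (\<sigma> x) * ?D - x * B2 x / b x = 0"
  proof (rule has_real_derivative_const_on_open_unique[rotated 3])
    fix y assume "y \<in> {r1<..<r2}"
    then have y: "r1 < y" "y < r2" by auto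
    show "ln (\<sigma> y) - R y = ln (\<sigma> x) - R x"
    proof (cases x y rule: linorder_cases)
      case less
      from strip_inv[OF x(1) less y(2)] show ?thesis ..
    next
      case greater
      from strip_inv[OF y(1) greater x(2)] show ?thesis .
    qed simp
  qed (use x in auto)
  then have "?D = \<sigma> x * (x * B2 x / b x)" using x\<sigma> by (simp add: inverse_eq_divide divide_eq_eq mult.commute)
  then have "((1 + x\<^sup>2) * g x - A2 x) - \<sigma> x * ((x + x\<^sup>2) * g x - 2 * x * B2 x) = \<sigma> x * (x * B2 x)"
    using xb by (simp add: field_simps)
  \<comment> \<open>After inserting \<open>equil\<close> only the divergence at the nullcline point
    is left, and it would have to vanish although \<open>\<sigma> x > \<tau> x\<close>.\<close>
  then have "g x * ((1 + x\<^sup>2) - \<sigma> x * (x + x\<^sup>2)) = 0"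
    using equil[OF x] by (simp add: algebra_simps)
  then have "1 + x\<^sup>2 = \<sigma> x * (x + x\<^sup>2)" using g_pos[OF strip_pos[OF x(1)]] by simp
  then show False using mean_gt[OF strip_pos[OF x(1)], of "\<sigma> x" "\<sigma> x"] strip_bounds(2)[OF x] by simp
qed

end

section \<open>The density of the value ratio\<close>

lemma AE_lborel_not_hyperplane:
  fixes a :: "'a::euclidean_space"
  assumes "a \<noteq> 0"
  shows "AE v in lborel. a \<bullet> v \<noteq> b"
proof -
  have "negligible {v. a \<bullet> v = b}" using assms by (intro negligible_hyperplane) simp
  then have "{v. a \<bullet> v = b} \<in> null_sets lebesgue" by (simp add: negligible_iff_null_sets)
  then have "{v. a \<bullet> v = b} \<in> null_sets lborel" by (subst (asm) null_sets_completion_iff) auto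
  then show ?thesis by (auto dest: AE_not_in)
qed

text \<open>Fubini with the coordinate along \<open>e\<close> split off: the inner integral replaces
  that coordinate by \<open>y\<close> and no longer depends on it, so the integral of \<psi> factors
  out. A \<psi> of mass 1 inserts an auxiliary variable at no cost.\<close>

lemma nn_integral_lborel_replace_coordinate:
  fixes h :: "'a::euclidean_space \<Rightarrow> ennreal" and \<psi> :: "real \<Rightarrow> ennreal"
  assumes e: "e \<in> Basis" and [measurable]: "h \<in> borel_measurable borel" "\<psi> \<in> borel_measurable borel"
  shows "(\<integral>\<^sup>+v. \<psi> (v \<bullet> e) * (\<integral>\<^sup>+y. h (v + (y - v \<bullet> e) *\<^sub>R e) \<partial>lborel) \<partial>lborel)
    = (\<integral>\<^sup>+y. \<psi> y \<partial>lborel) * (\<integral>\<^sup>+v. h v \<partial>lborel)"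
proof -
  define I where "I = (Basis :: 'a set) - {e}"
  define S where "S = (\<lambda>x::'a \<Rightarrow> real. \<Sum>b\<in>Basis. x b *\<^sub>R b)"
  have I: "finite I" "e \<notin> I" "insert e I = Basis" using e by (auto simp: I_def)
  interpret product_sigma_finite "\<lambda>_::'a. lborel :: real measure" by standard
  have S[measurable]: "S \<in> borel_measurable (PiM Basis (\<lambda>_. lborel))"
    unfolding S_def by measurable
  have iter: "(\<integral>\<^sup>+v. k v \<partial>lborel) = (\<integral>\<^sup>+x. \<integral>\<^sup>+y. k (S (x(e := y))) \<partial>lborel \<partial>PiM I (\<lambda>_. lborel))"
    if [measurable]: "k \<in> borel_measurable borel" for k :: "'a \<Rightarrow> ennreal"
  proof -
    have "(\<integral>\<^sup>+v. k v \<partial>lborel) = (\<integral>\<^sup>+x. k (S x) \<partial>PiM Basis (\<lambda>_. lborel))"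
      by (subst lborel_eq) (simp add: nn_integral_distr S_def)
    also have "\<dots> = (\<integral>\<^sup>+x. k (S x) \<partial>PiM (insert e I) (\<lambda>_. lborel))" by (simp add: I)
    also have "\<dots> = (\<integral>\<^sup>+x. \<integral>\<^sup>+y. k (S (x(e := y))) \<partial>lborel \<partial>PiM I (\<lambda>_. lborel))"
      by (rule product_nn_integral_insert) (simp_all add: I)
    finally show ?thesis .
  qed
  have S_upd: "S (x(e := y)) = y *\<^sub>R e + (\<Sum>b\<in>I. x b *\<^sub>R b)" for x y
  proof -
    have "S (x(e := y)) = (\<Sum>b\<in>insert e I. (x(e := y)) b *\<^sub>R b)" by (simp add: S_def I)
    also have "\<dots> = y *\<^sub>R e + (\<Sum>b\<in>I. (x(e := y)) b *\<^sub>R b)" by (subst sum.insert) (simp_all add: I(1,2))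
    also have "(\<Sum>b\<in>I. (x(e := y)) b *\<^sub>R b) = (\<Sum>b\<in>I. x b *\<^sub>R b)"
      by (rule sum.cong) (use I in auto)
    finally show ?thesis .
  qed
  have S_e: "S (x(e := y)) \<bullet> e = y" for x y
  proof -
    have "(\<Sum>b\<in>I. x b *\<^sub>R b) \<bullet> e = (\<Sum>b\<in>I. x b * (b \<bullet> e))" by (simp add: inner_sum_left)
    also have "\<dots> = 0" using e by (intro sum.neutral) (auto simp: I_def inner_Basis)
    finally show ?thesis using e by (simp add: S_upd inner_add_left)
  qed
  have S_rep: "S (x(e := z)) + (y - z) *\<^sub>R e = S (x(e := y))" for x y z
    by (simp add: S_upd algebra_simps)
  have "(\<integral>\<^sup>+v. \<psi> (v \<bullet> e) * (\<integral>\<^sup>+y. h (v + (y - v \<bullet> e) *\<^sub>R e) \<partial>lborel) \<partial>lborel)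
    = (\<integral>\<^sup>+x. \<integral>\<^sup>+z. \<psi> z * (\<integral>\<^sup>+y. h (S (x(e := y))) \<partial>lborel) \<partial>lborel \<partial>PiM I (\<lambda>_. lborel))"
    by (subst iter) (simp_all only: S_e S_rep, measurable)
  also have "\<dots> = (\<integral>\<^sup>+x. (\<integral>\<^sup>+z. \<psi> z \<partial>lborel) * (\<integral>\<^sup>+y. h (S (x(e := y))) \<partial>lborel) \<partial>PiM I (\<lambda>_. lborel))"
    by (simp add: nn_integral_multc)
  also have "\<dots> = (\<integral>\<^sup>+z. \<psi> z \<partial>lborel) * (\<integral>\<^sup>+x. (\<integral>\<^sup>+y. h (S (x(e := y))) \<partial>lborel) \<partial>PiM I (\<lambda>_. lborel))"
  proof (rule nn_integral_cmult)
    have [measurable]: "(\<lambda>x. S ((fst x)(e := snd x))) \<in> borel_measurable ((PiM I (\<lambda>_. lborel)) \<Otimes>\<^sub>M (lborel :: real measure))"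
      unfolding S_upd by measurable
    have "(\<lambda>x. h (S ((fst x)(e := snd x)))) \<in> borel_measurable ((PiM I (\<lambda>_. lborel)) \<Otimes>\<^sub>M (lborel :: real measure))"
      by measurable
    then show "(\<lambda>x. \<integral>\<^sup>+y. h (S (x(e := y))) \<partial>lborel) \<in> borel_measurable (PiM I (\<lambda>_. lborel))"
      by (intro lborel.borel_measurable_nn_integral) (simp add: case_prod_beta')
  qed
  also have "\<dots> = (\<integral>\<^sup>+y. \<psi> y \<partial>lborel) * (\<integral>\<^sup>+v. h v \<partial>lborel)" by (simp add: iter)
  finally show ?thesis .
qed

text \<open>The integrand does not depend on the coordinate \<open>v \<bullet> e\<close>, which only ranges over an
  interval of length \<open>M\<close>; integrating over it and dividing by \<open>M\<close> avoids working in a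
  space of one dimension less.\<close>

definition ratio_density :: "real \<Rightarrow> ('a::euclidean_space \<Rightarrow> real) \<Rightarrow> 'a \<Rightarrow> 'a \<Rightarrow> real \<Rightarrow> real" where
  "ratio_density M F d e u =
     (\<integral>v. indicator {0..M} (v \<bullet> e) * (v \<bullet> d)\<^sup>2 * F (v + (u * (v \<bullet> d) - v \<bullet> e) *\<^sub>R e) \<partial>lborel) / M"

definition std_box :: "real \<Rightarrow> 'a::euclidean_space set" where
  "std_box M = cbox 0 (M *\<^sub>R One)"

lemma mem_std_box: "v \<in> std_box M \<longleftrightarrow> (\<forall>b\<in>Basis. 0 \<le> v \<bullet> b \<and> v \<bullet> b \<le> M)"
  by (auto simp: std_box_def mem_box)

lemma inner_replace_coordinate:
  fixes v :: "'a::euclidean_space"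
  assumes "b \<in> Basis" "e \<in> Basis"
  shows "(v + (y - v \<bullet> e) *\<^sub>R e) \<bullet> b = (if b = e then y else v \<bullet> b)"
  using assms by (auto simp: inner_add_left inner_Basis)

lemma mem_std_box_replace_coordinate:
  fixes v :: "'a::euclidean_space"
  assumes "e \<in> Basis"
  shows "v \<bullet> e \<in> {0..M} \<and> v + (y - v \<bullet> e) *\<^sub>R e \<in> std_box M \<longleftrightarrow> v \<in> std_box M \<and> 0 \<le> y \<and> y \<le> M"
  using assms by (auto simp: mem_std_box inner_replace_coordinate split: if_splits)

section \<open>Continuous positive densities on a box\<close>

locale box_density =
  fixes M :: real and f :: "'a::euclidean_space \<Rightarrow> real"
  assumes M_pos: "M > 0" and f_cont: "continuous_on (std_box M) f"
    and f_pos: "\<And>v. v \<in> std_box M \<Longrightarrow> f v > 0"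
begin

definition F :: "'a \<Rightarrow> real" where "F v = indicator (std_box M) v * f v"

lemma std_box_sets [measurable]: "std_box M \<in> sets borel"
  by (simp add: std_box_def)

lemma F_measurable [measurable]: "F \<in> borel_measurable borel"
proof -
  have "(\<lambda>v. indicator (std_box M) v *\<^sub>R f v) \<in> borel_measurable borel"
    by (rule borel_measurable_continuous_on_indicator[OF _ f_cont]) simp
  then show ?thesis unfolding F_def[abs_def] by simp
qed

lemma F_nonneg: "F v \<ge> 0"
  using f_pos[of v] by (auto simp: F_def indicator_def)

lemma F_bounded: obtains B where "B > 0" "\<And>v. F v \<le> B"
proof -
  have "bounded (f ` std_box M)"
    by (rule compact_imp_bounded, rule compact_continuous_image[OF f_cont]) (simp add: std_box_def)
  then obtain B where "B > 0" "\<And>v. v \<in> std_box M \<Longrightarrow> \<bar>f v\<bar> \<le> B"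
    by (auto simp: bounded_pos)
  then show ?thesis using that[of B] by (force simp: F_def indicator_def)
qed

lemma f_lower: obtains c where "c > 0" "\<And>v. v \<in> std_box M \<Longrightarrow> c \<le> f v"
proof -
  have "(0::'a) \<in> std_box M" using M_pos by (simp add: mem_std_box)
  then obtain x where "x \<in> std_box M" "\<And>v. v \<in> std_box M \<Longrightarrow> f x \<le> f v"
    using continuous_attains_inf[OF _ _ f_cont] by (auto simp: std_box_def)
  then show ?thesis using that f_pos by blast
qed

lemma integrable_box_bounded:
  fixes k :: "'a \<Rightarrow> real"
  assumes [measurable]: "k \<in> borel_measurable borel"
    and "\<And>v. v \<notin> std_box M \<Longrightarrow> k v = 0" "\<And>v. \<bar>k v\<bar> \<le> C"
  shows "integrable lborel k"
proof (rule Bochner_Integration.integrable_bound[of _ "\<lambda>v. indicator (std_box M) v * C"])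
  show "integrable lborel (\<lambda>v::'a. indicator (std_box M) v * C)"
    by (intro integrable_mult_left integrable_real_indicator) (simp add: std_box_def, simp only: std_box_def, rule emeasure_lborel_cbox_finite)
  show "AE v in lborel. norm (k v) \<le> norm (indicator (std_box M) v * C)"
    proof (rule AE_I2)
    fix v show "norm (k v) \<le> norm (indicator (std_box M) v * C)"
      using assms(2)[of v] assms(3)[of v] by (cases "v \<in> std_box M") auto
  qed
qed simp

context
  fixes d e :: 'a
  assumes d: "d \<in> Basis" and e: "e \<in> Basis" and de: "d \<noteq> e"
begin

abbreviation "dens \<equiv> ratio_density M F d e"

text \<open>One factor \<open>v \<bullet> d\<close> is the weight, the other the Jacobian of the
  substitution \<open>y = u * (v \<bullet> d)\<close>.\<close>

abbreviation "slice u v \<equiv> indicator {0..M} (v \<bullet> e) * (v \<bullet> d)\<^sup>2 * F (v + (u * (v \<bullet> d) - v \<bullet> e) *\<^sub>R e)"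

lemma slice_measurable [measurable]: "(\<lambda>v. slice u v) \<in> borel_measurable borel"
  by measurable

lemma slice_nonneg: "slice u v \<ge> 0"
  using F_nonneg by simp

lemma slice_eq: "slice u v =
    (if v \<in> std_box M \<and> 0 \<le> u * (v \<bullet> d) \<and> u * (v \<bullet> d) \<le> M
     then (v \<bullet> d)\<^sup>2 * f (v + (u * (v \<bullet> d) - v \<bullet> e) *\<^sub>R e) else 0)"
  using mem_std_box_replace_coordinate[OF e, of v M "u * (v \<bullet> d)"]
  by (auto simp: F_def indicator_def)

lemma slice_le:
  assumes "\<And>v. F v \<le> B" shows "slice u v \<le> M\<^sup>2 * B"
proof (cases "v \<in> std_box M")
  case True
  then have "(v \<bullet> d)\<^sup>2 \<le> M\<^sup>2" using d by (intro power_mono) (auto simp: mem_std_box)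
  then have "indicator {0..M} (v \<bullet> e) * (v \<bullet> d)\<^sup>2 * F (v + (u * (v \<bullet> d) - v \<bullet> e) *\<^sub>R e) \<le> M\<^sup>2 * B"
    by (intro mult_mono F_nonneg assms) (auto simp: indicator_def)
  then show ?thesis .
next
  case False
  have "B \<ge> 0" using F_nonneg[of 0] assms[of 0] by linarith
  then show ?thesis using False by (simp only: slice_eq) simp
qed

lemma slice_integrable: "integrable lborel (\<lambda>v. slice u v)"
proof -
  obtain B where B: "\<And>v. F v \<le> B" using F_bounded by blast
  show ?thesis
  proof (rule integrable_box_bounded)
    show "slice u v = 0" if "v \<notin> std_box M" for v using that by (simp only: slice_eq) simp
    show "\<bar>slice u v\<bar> \<le> M\<^sup>2 * B" for v using slice_le[OF B, of v u] slice_nonneg[of v u] by linarith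
  qed simp
qed

lemma dens_nonneg: "dens u \<ge> 0"
  unfolding ratio_density_def using M_pos by (intro divide_nonneg_pos Bochner_Integration.integral_nonneg slice_nonneg)

lemma ennreal_dens: "ennreal (dens u) = ennreal (1/M) * (\<integral>\<^sup>+v. ennreal (slice u v) \<partial>lborel)"
  unfolding ratio_density_def
  by (subst nn_integral_eq_integral[OF slice_integrable])
    (use M_pos F_nonneg in \<open>auto simp: ennreal_mult'[symmetric] Bochner_Integration.integral_nonneg\<close>)

lemma dens_measurable [measurable]: "dens \<in> borel_measurable borel"
proof -
  have "(\<lambda>(u,v). slice u v) \<in> borel_measurable (borel \<Otimes>\<^sub>M lborel)"
    by measurable
  then show ?thesis unfolding ratio_density_def by measurable
qed

text \<open>Replace the coordinate along \<open>e\<close> by a fresh \<open>y\<close>, with the old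
  coordinate averaged uniformly over \<open>{0..M}\<close>; then substitute
  \<open>y = u * (v \<bullet> d)\<close> and exchange the integrals.\<close>

lemma nn_integral_ratio:
  assumes [measurable]: "\<psi> \<in> borel_measurable borel"
  shows "(\<integral>\<^sup>+v. ennreal (F v * (v \<bullet> d)) * \<psi> ((v \<bullet> e) / (v \<bullet> d)) \<partial>lborel) = (\<integral>\<^sup>+u. ennreal (dens u) * \<psi> u \<partial>lborel)"
    (is "integral\<^sup>N _ ?h = _")
proof -
  have "(\<integral>\<^sup>+y. indicator {0..M} y * ennreal (1/M) \<partial>lborel) = ennreal M * ennreal (1/M)"
    using M_pos by (simp add: nn_integral_multc)
  also have "\<dots> = 1" using M_pos by (simp add: ennreal_mult'[symmetric])
  finally have "integral\<^sup>N lborel ?h =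
     (\<integral>\<^sup>+v. (indicator {0..M} (v \<bullet> e) * ennreal (1/M)) * (\<integral>\<^sup>+y. ?h (v + (y - v \<bullet> e) *\<^sub>R e) \<partial>lborel) \<partial>lborel)"
    by (subst nn_integral_lborel_replace_coordinate[OF e]) simp_all
  also have "\<dots> = (\<integral>\<^sup>+v. \<integral>\<^sup>+u. ennreal (1/M) * ennreal (slice u v) * \<psi> u \<partial>lborel \<partial>lborel)"
  proof (rule nn_integral_cong)
    fix v :: 'a
    have h: "?h (v + (y - v \<bullet> e) *\<^sub>R e) = ennreal (F (v + (y - v \<bullet> e) *\<^sub>R e) * (v \<bullet> d)) * \<psi> (y / (v \<bullet> d))" for y
      using d e de by (simp add: inner_replace_coordinate)
    have F0: "F (v + (y - v \<bullet> e) *\<^sub>R e) = 0" if "v \<bullet> d < 0" for y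
    proof -
      have "v + (y - v \<bullet> e) *\<^sub>R e \<notin> std_box M"
        using that d e de inner_replace_coordinate[OF d e, of v y] unfolding mem_std_box by force
      then show ?thesis by (simp add: F_def)
    qed
    show "(indicator {0..M} (v \<bullet> e) * ennreal (1/M)) * (\<integral>\<^sup>+y. ?h (v + (y - v \<bullet> e) *\<^sub>R e) \<partial>lborel)
      = (\<integral>\<^sup>+u. ennreal (1/M) * ennreal (slice u v) * \<psi> u \<partial>lborel)"
    proof (cases "v \<bullet> d > 0")
      case True
      define x where "x = v \<bullet> d"
      have x: "x > 0" using True by (simp add: x_def)
      have "(\<integral>\<^sup>+y. ?h (v + (y - v \<bullet> e) *\<^sub>R e) \<partial>lborel) = (\<integral>\<^sup>+y. ennreal (F (v + (y - v \<bullet> e) *\<^sub>R e) * x) * \<psi> (y / x) \<partial>lborel)"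
        unfolding h x_def ..
      also have "\<dots> = \<bar>x\<bar> * (\<integral>\<^sup>+u. ennreal (F (v + ((0 + x * u) - v \<bullet> e) *\<^sub>R e) * x) * \<psi> ((0 + x * u) / x) \<partial>lborel)"
        using x by (intro nn_integral_real_affine) auto
      also have "\<dots> = (\<integral>\<^sup>+u. ennreal x * (ennreal (F (v + (u * x - v \<bullet> e) *\<^sub>R e) * x) * \<psi> u) \<partial>lborel)"
        using x by (subst nn_integral_cmult) (auto simp: mult.commute)
      finally have "(indicator {0..M} (v \<bullet> e) * ennreal (1/M)) * (\<integral>\<^sup>+y. ?h (v + (y - v \<bullet> e) *\<^sub>R e) \<partial>lborel)
        = (\<integral>\<^sup>+u. (indicator {0..M} (v \<bullet> e) * ennreal (1/M)) * (ennreal x * (ennreal (F (v + (u * x - v \<bullet> e) *\<^sub>R e) * x) * \<psi> u)) \<partial>lborel)"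
        by (simp add: nn_integral_cmult)
      also have "\<dots> = (\<integral>\<^sup>+u. ennreal (1/M) * ennreal (indicator {0..M} (v \<bullet> e) * x\<^sup>2 * F (v + (u * x - v \<bullet> e) *\<^sub>R e)) * \<psi> u \<partial>lborel)"
      proof (rule nn_integral_cong)
        fix u
        have "ennreal (x\<^sup>2 * F (v + (u * x - v \<bullet> e) *\<^sub>R e)) = ennreal x * ennreal (F (v + (u * x - v \<bullet> e) *\<^sub>R e) * x)"
          using x F_nonneg by (subst ennreal_mult[symmetric]) (auto simp: power2_eq_square mult_ac)
        then show "(indicator {0..M} (v \<bullet> e) * ennreal (1/M)) * (ennreal x * (ennreal (F (v + (u * x - v \<bullet> e) *\<^sub>R e) * x) * \<psi> u))
          = ennreal (1/M) * ennreal (indicator {0..M} (v \<bullet> e) * x\<^sup>2 * F (v + (u * x - v \<bullet> e) *\<^sub>R e)) * \<psi> u"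
          by (auto simp: indicator_def mult_ac)
      qed
      finally show ?thesis unfolding x_def .
    next
      case False
      \<comment> \<open>The weight kills the points with \<open>v \<bullet> d = 0\<close>, where the
        ratio is a division by zero, and \<open>F\<close> vanishes for
        \<open>v \<bullet> d < 0\<close>.\<close>
      then consider "v \<bullet> d = 0" | "v \<bullet> d < 0" by linarith
      then show ?thesis unfolding h by cases (use F0 in simp_all)
    qed
  qed
  also have "\<dots> = (\<integral>\<^sup>+u. \<integral>\<^sup>+v. ennreal (1/M) * ennreal (slice u v) * \<psi> u \<partial>lborel \<partial>lborel)"
    by (rule lborel_pair.Fubini') measurable
  also have "\<dots> = (\<integral>\<^sup>+u. ennreal (dens u) * \<psi> u \<partial>lborel)"
    by (simp add: nn_integral_multc nn_integral_cmult ennreal_dens)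
  finally show ?thesis .
qed

text \<open>Stated as an equality of measures so that the formula extends to signed integrands and
  to integrability.\<close>

lemma distr_ratio:
  "distr (density lborel (\<lambda>v. ennreal (F v * (v \<bullet> d)))) borel (\<lambda>v. (v \<bullet> e) / (v \<bullet> d)) = density lborel (\<lambda>u. ennreal (dens u))"
proof (rule measure_eqI)
  fix A assume "A \<in> sets (distr (density lborel (\<lambda>v. ennreal (F v * (v \<bullet> d)))) borel (\<lambda>v. (v \<bullet> e) / (v \<bullet> d)))"
  then have A[measurable]: "A \<in> sets borel" by simp
  have "emeasure (distr (density lborel (\<lambda>v. ennreal (F v * (v \<bullet> d)))) borel (\<lambda>v. (v \<bullet> e) / (v \<bullet> d))) A
    = (\<integral>\<^sup>+v. indicator A v \<partial>(distr (density lborel (\<lambda>v. ennreal (F v * (v \<bullet> d)))) borel (\<lambda>v. (v \<bullet> e) / (v \<bullet> d))))"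
    by simp
  also have "\<dots> = (\<integral>\<^sup>+v. ennreal (F v * (v \<bullet> d)) * indicator A ((v \<bullet> e) / (v \<bullet> d)) \<partial>lborel)"
    by (subst nn_integral_distr) (simp_all add: nn_integral_density)
  also have "\<dots> = (\<integral>\<^sup>+u. ennreal (dens u) * indicator A u \<partial>lborel)"
    by (rule nn_integral_ratio) simp
  also have "\<dots> = emeasure (density lborel (\<lambda>u. ennreal (dens u))) A"
    by (subst emeasure_density) auto
  finally show "emeasure (distr (density lborel (\<lambda>v. ennreal (F v * (v \<bullet> d)))) borel (\<lambda>v. (v \<bullet> e) / (v \<bullet> d))) A
    = emeasure (density lborel (\<lambda>u. ennreal (dens u))) A" .
qed simp

lemma F_inner_nonneg: "F v * (v \<bullet> d) \<ge> 0"
  using F_nonneg d by (auto simp: F_def indicator_def mem_std_box intro!: mult_nonneg_nonneg less_imp_le[OF f_pos])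

lemma
  fixes \<psi> :: "real \<Rightarrow> real"
  assumes [measurable]: "\<psi> \<in> borel_measurable borel"
  shows integral_ratio: "(\<integral>v. F v * (v \<bullet> d) * \<psi> ((v \<bullet> e) / (v \<bullet> d)) \<partial>lborel) = (\<integral>u. dens u * \<psi> u \<partial>lborel)"
    and integrable_ratio: "integrable lborel (\<lambda>v. F v * (v \<bullet> d) * \<psi> ((v \<bullet> e) / (v \<bullet> d))) \<longleftrightarrow> integrable lborel (\<lambda>u. dens u * \<psi> u)"
proof -
  let ?D = "density lborel (\<lambda>v. ennreal (F v * (v \<bullet> d)))"
  have "(\<integral>u. dens u * \<psi> u \<partial>lborel) = (\<integral>u. \<psi> u \<partial>distr ?D borel (\<lambda>v. (v \<bullet> e) / (v \<bullet> d)))"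
    unfolding distr_ratio by (subst integral_real_density) (auto simp: dens_nonneg)
  also have "\<dots> = (\<integral>v. F v * (v \<bullet> d) * \<psi> ((v \<bullet> e) / (v \<bullet> d)) \<partial>lborel)"
    by (subst integral_distr) (auto simp: F_inner_nonneg integral_real_density)
  finally show "(\<integral>v. F v * (v \<bullet> d) * \<psi> ((v \<bullet> e) / (v \<bullet> d)) \<partial>lborel) = (\<integral>u. dens u * \<psi> u \<partial>lborel)" ..
  have "integrable lborel (\<lambda>u. dens u * \<psi> u) \<longleftrightarrow> integrable (distr ?D borel (\<lambda>v. (v \<bullet> e) / (v \<bullet> d))) \<psi>"
    unfolding distr_ratio by (subst integrable_real_density) (auto simp: dens_nonneg)
  also have "\<dots> \<longleftrightarrow> integrable lborel (\<lambda>v. F v * (v \<bullet> d) * \<psi> ((v \<bullet> e) / (v \<bullet> d)))"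
    by (subst integrable_distr_eq) (auto simp: F_inner_nonneg integrable_real_density)
  finally show "integrable lborel (\<lambda>v. F v * (v \<bullet> d) * \<psi> ((v \<bullet> e) / (v \<bullet> d))) \<longleftrightarrow> integrable lborel (\<lambda>u. dens u * \<psi> u)" ..
qed

text \<open>Dominated convergence. For \<open>u > 0\<close> the slice can jump only where the new
  coordinate \<open>u * (v \<bullet> d)\<close> leaves the box, that is on the null hyperplane
  \<open>u * (v \<bullet> d) = M\<close>.\<close>

lemma dens_continuous: "continuous_on {0<..} dens"
  unfolding continuous_on_sequentially
proof (intro allI ballI impI, elim conjE)
  fix X u assume "u \<in> {0::real<..}" and X0: "\<forall>n. X n \<in> {0<..}" and X: "X \<longlonglongrightarrow> u"
  then have u: "u > 0" by simp
  obtain B where B: "\<And>v. F v \<le> B" using F_bounded by blast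
  have "(\<lambda>n. \<integral>v. slice (X n) v \<partial>lborel) \<longlonglongrightarrow> (\<integral>v. slice u v \<partial>lborel)"
  proof (rule integral_dominated_convergence)
    show "integrable lborel (\<lambda>v::'a. indicator (std_box M) v * (M\<^sup>2 * B))"
    proof (rule integrable_box_bounded)
      show "\<bar>indicator (std_box M) v * (M\<^sup>2 * B)\<bar> \<le> \<bar>M\<^sup>2 * B\<bar>" for v :: 'a by (auto simp: indicator_def)
    qed auto
    show "AE v in lborel. norm (slice (X n) v) \<le> indicator (std_box M) v * (M\<^sup>2 * B)" for n
    proof (rule AE_I2)
      fix v
      show "norm (slice (X n) v) \<le> indicator (std_box M) v * (M\<^sup>2 * B)"
      proof (cases "v \<in> std_box M")
        case True
        then show ?thesis using slice_le[OF B, of v "X n"] slice_nonneg[of v "X n"] by simp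
      next
        case False
        then show ?thesis by (simp only: slice_eq) simp
      qed
    qed
    have "AE v in lborel. d \<bullet> v \<noteq> M / u"
      using d by (intro AE_lborel_not_hyperplane) auto
    then show "AE v in lborel. (\<lambda>n. slice (X n) v) \<longlonglongrightarrow> slice u v"
    proof (eventually_elim)
      fix v assume "d \<bullet> v \<noteq> M / u"
      then have ne: "u * (v \<bullet> d) \<noteq> M" using u by (auto simp: field_simps inner_commute)
      have lim: "(\<lambda>n. X n * (v \<bullet> d)) \<longlonglongrightarrow> u * (v \<bullet> d)" by (intro tendsto_intros X)
      consider "v \<notin> std_box M" | "v \<in> std_box M" "u * (v \<bullet> d) > M" | "v \<in> std_box M" "u * (v \<bullet> d) < M"
        using ne by linarith
      then show "(\<lambda>n. slice (X n) v) \<longlonglongrightarrow> slice u v"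
      proof cases
        case 1
        then show ?thesis by (simp only: slice_eq) simp
      next
        case 2
        have "\<forall>\<^sub>F n in sequentially. X n * (v \<bullet> d) > M" using lim 2 by (simp add: order_tendstoD)
        then have "\<forall>\<^sub>F n in sequentially. slice u v = slice (X n) v"
          by eventually_elim (use 2 in \<open>simp only: slice_eq, simp\<close>)
        then show ?thesis by (rule Lim_transform_eventually[OF tendsto_const])
      next
        case 3
        have nn: "v \<bullet> d \<ge> 0" using 3 d by (simp add: mem_std_box)
        have pos: "X n * (v \<bullet> d) \<ge> 0" for n using X0 nn by (simp add: less_imp_le)
        have ev: "\<forall>\<^sub>F n in sequentially. X n * (v \<bullet> d) < M" using lim 3 by (simp add: order_tendstoD)
        have box: "v + (y - v \<bullet> e) *\<^sub>R e \<in> std_box M" if "0 \<le> y" "y \<le> M" for y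
          using that 3 mem_std_box_replace_coordinate[OF e, of v M y] by blast
        have "(\<lambda>n. f (v + (X n * (v \<bullet> d) - v \<bullet> e) *\<^sub>R e)) \<longlonglongrightarrow> f (v + (u * (v \<bullet> d) - v \<bullet> e) *\<^sub>R e)"
        proof (rule continuous_on_tendsto_compose[OF f_cont])
          show "(\<lambda>n. v + (X n * (v \<bullet> d) - v \<bullet> e) *\<^sub>R e) \<longlonglongrightarrow> v + (u * (v \<bullet> d) - v \<bullet> e) *\<^sub>R e"
            by (intro tendsto_intros X)
          show "v + (u * (v \<bullet> d) - v \<bullet> e) *\<^sub>R e \<in> std_box M"
            using 3 nn u by (intro box) auto
          show "\<forall>\<^sub>F n in sequentially. v + (X n * (v \<bullet> d) - v \<bullet> e) *\<^sub>R e \<in> std_box M"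
            using ev by eventually_elim (use pos box in \<open>auto intro: less_imp_le\<close>)
        qed
        then have "(\<lambda>n. (v \<bullet> d)\<^sup>2 * f (v + (X n * (v \<bullet> d) - v \<bullet> e) *\<^sub>R e)) \<longlonglongrightarrow> (v \<bullet> d)\<^sup>2 * f (v + (u * (v \<bullet> d) - v \<bullet> e) *\<^sub>R e)"
          by (intro tendsto_intros)
        then have "(\<lambda>n. (v \<bullet> d)\<^sup>2 * f (v + (X n * (v \<bullet> d) - v \<bullet> e) *\<^sub>R e)) \<longlonglongrightarrow> slice u v"
          using 3 nn u by (simp only: slice_eq) simp
        moreover have "\<forall>\<^sub>F n in sequentially. (v \<bullet> d)\<^sup>2 * f (v + (X n * (v \<bullet> d) - v \<bullet> e) *\<^sub>R e) = slice (X n) v"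
          using ev by eventually_elim (use 3 pos in \<open>simp only: slice_eq, simp\<close>)
        ultimately show ?thesis by (rule Lim_transform_eventually)
      qed
    qed
  qed auto
  then show "(dens \<circ> X) \<longlonglongrightarrow> dens u"
    unfolding ratio_density_def comp_def using M_pos by (intro tendsto_intros) auto
qed

lemma dens_pos:
  assumes u: "u > 0" shows "dens u > 0"
proof -
  obtain c where c: "c > 0" "\<And>v. v \<in> std_box M \<Longrightarrow> c \<le> f v" using f_lower by blast
  \<comment> \<open>On the cube \<open>Q\<close> both \<open>v\<close> and the vector with replaced
    coordinate stay in the box, since \<open>u * \<delta> \<le> M\<close>, so the slice has a
    positive lower bound there.\<close>
  define \<delta> where "\<delta> = min M (M / u)"
  have \<delta>: "\<delta> > 0" "\<delta> \<le> M" "u * \<delta> \<le> M" using u M_pos by (auto simp: \<delta>_def min_def field_simps)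
  define Q where "Q = cbox ((\<delta>/2) *\<^sub>R One) (\<delta> *\<^sub>R One :: 'a)"
  have Q: "slice u v \<ge> c * (\<delta>/2)\<^sup>2" if "v \<in> Q" for v
  proof -
    have vb: "\<delta>/2 \<le> v \<bullet> b" "v \<bullet> b \<le> \<delta>" if "b \<in> Basis" for b using that \<open>v \<in> Q\<close> by (auto simp: Q_def mem_box)
    have v: "v \<in> std_box M" using vb \<delta> by (force simp: mem_std_box)
    have 1: "0 \<le> u * (v \<bullet> d)" using vb[OF d] \<delta> u by simp
    have 2: "u * (v \<bullet> d) \<le> M" using order_trans[OF mult_left_mono[OF vb(2)[OF d], of u] \<delta>(3)] u by simp
    have 3: "v + (u * (v \<bullet> d) - v \<bullet> e) *\<^sub>R e \<in> std_box M"
      using 1 2 v mem_std_box_replace_coordinate[OF e] by blast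
    have "(\<delta>/2)\<^sup>2 \<le> (v \<bullet> d)\<^sup>2" using vb[OF d] \<delta> by (intro power_mono) auto
    then have "c * (\<delta>/2)\<^sup>2 \<le> f (v + (u * (v \<bullet> d) - v \<bullet> e) *\<^sub>R e) * (v \<bullet> d)\<^sup>2"
      using c(2)[OF 3] c(1) by (intro mult_mono) auto
    then show ?thesis using v 1 2 by (simp only: slice_eq) (simp add: mult.commute)
  qed
  have mQ: "measure lborel Q = (\<delta>/2) ^ DIM('a)"
    unfolding Q_def using \<delta> by (subst measure_lborel_cbox) (auto simp: inner_diff_left)
  have "0 < (c * (\<delta>/2)\<^sup>2) * measure lborel Q" using c \<delta> by (simp add: mQ)
  also have "\<dots> = (\<integral>v. indicator Q v * (c * (\<delta>/2)\<^sup>2) \<partial>lborel)" by (simp add: Q_def)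
  also have "\<dots> \<le> (\<integral>v. slice u v \<partial>lborel)"
  proof (rule integral_mono)
    show "integrable lborel (\<lambda>v. indicator Q v * (c * (\<delta>/2)\<^sup>2))"
      unfolding Q_def by (intro integrable_mult_left integrable_real_indicator emeasure_lborel_cbox_finite) auto
    show "indicator Q v * (c * (\<delta>/2)\<^sup>2) \<le> slice u v" for v
      using Q[of v] slice_nonneg[of v u] by (cases "v \<in> Q") auto
  qed (rule slice_integrable)
  finally show ?thesis unfolding ratio_density_def using M_pos by simp
qed

end
end

section \<open>Expected utilities in terms of the ratio density\<close>

lemma has_real_derivative_cumulative:
  fixes h :: "real \<Rightarrow> real"
  assumes int: "integrable lborel h" and cont: "continuous_on {0<..} h" and x: "x > 0"
  shows "((\<lambda>r. \<integral>u. h u * indicator {..<r} u \<partial>lborel) has_real_derivative h x) (at x)"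
proof -
  \<comment> \<open>Continuity holds only on the positive half-line, so the part below a fixed
    \<open>c\<close> in \<open>(0, x)\<close> is split off as a constant.\<close>
  define c where "c = x / 2"
  have c: "0 < c" "c < x" using x by (auto simp: c_def)
  have [measurable]: "h \<in> borel_measurable borel" using int by auto
  have ind: "integrable lborel (\<lambda>u. h u * indicator S u)" if "S \<in> sets borel" for S
    using integrable_mult_indicator[of S lborel h] int that by (simp add: mult.commute)
  have split: "(\<integral>u. h u * indicator {..<r} u \<partial>lborel) = (\<integral>u. h u * indicator {..<c} u \<partial>lborel) + integral {c..r} h"
    if "r > c" for r
  proof -
    have "set_integrable lborel {c..r} h"
      unfolding set_integrable_def using ind[of "{c..r}"] by (simp add: mult.commute)
    then have "integral {c..r} h = (\<integral>u. h u * indicator {c..r} u \<partial>lborel)"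
      by (subst set_borel_integral_eq_integral(2)[symmetric]) (simp_all add: set_lebesgue_integral_def mult.commute)
    moreover have "(\<integral>u. h u * indicator {..<r} u \<partial>lborel) = (\<integral>u. h u * indicator {..<c} u + h u * indicator {c..r} u \<partial>lborel)"
    proof (rule integral_cong_AE)
      show "AE u in lborel. h u * indicator {..<r} u = h u * indicator {..<c} u + h u * indicator {c..r} u"
        using AE_lborel_singleton[of r] by eventually_elim (use that in \<open>auto simp: indicator_def\<close>)
    qed auto
    ultimately show ?thesis by (simp add: ind)
  qed
  have "((\<lambda>r. integral {c..r} h) has_real_derivative h x) (at x within {c..2*x})"
    using c by (intro integral_has_real_derivative continuous_on_subset[OF cont]) auto
  then have "((\<lambda>r. integral {c..r} h) has_real_derivative h x) (at x)"
    using c x by (simp add: at_within_Icc_at)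
  then have "((\<lambda>r. (\<integral>u. h u * indicator {..<c} u \<partial>lborel) + integral {c..r} h) has_real_derivative h x) (at x)"
    by (auto intro!: derivative_eq_intros)
  then show ?thesis
    by (rule has_field_derivative_transform_within_open[where S = "{c<..}"]) (use c split in auto)
qed

lemma integral_pos_of_pos_on_interval:
  fixes h :: "real \<Rightarrow> real"
  assumes "integrable lborel h" "\<And>u. h u \<ge> 0" "c < d" "\<And>u. c < u \<Longrightarrow> u < d \<Longrightarrow> h u > 0"
  shows "(\<integral>u. h u \<partial>lborel) > 0"
proof (rule ccontr)
  assume "\<not> ?thesis"
  then have "(\<integral>u. h u \<partial>lborel) = 0"
    using Bochner_Integration.integral_nonneg[of lborel h] assms(2) by (simp add: order_antisym)
  then have "AE u in lborel. h u = 0"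
    using integral_nonneg_eq_0_iff_AE[OF assms(1)] assms(2) by simp
  then have "AE u in lborel. u \<notin> {c<..<d}"
    by eventually_elim (use assms(4) in force)
  then have "emeasure lborel {c<..<d} = 0"
    by (subst (asm) AE_iff_measurable[where N = "{c<..<d}"]) auto
  then show False using assms(3) by simp
qed

section \<open>From the valuation box to the ratio density\<close>

lemma val_box_eq_std_box: "val_box M = std_box M"
  by (auto simp: val_box_def mem_std_box Basis_prod_def Basis_vec_def ball_Un inner_axis)

lemma sp_alloc_bounds: "0 \<le> sp_alloc x y" "sp_alloc x y \<le> 1"
  by (auto simp: sp_alloc_def)

locale ros = box_density M f for M :: real and f :: "(real^'k::finite) \<times> (real^'k) \<Rightarrow> real"
begin

abbreviation val1 :: "'k \<Rightarrow> (real^'k) \<times> (real^'k)" where "val1 j \<equiv> (axis j 1, 0)"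
abbreviation val2 :: "'k \<Rightarrow> (real^'k) \<times> (real^'k)" where "val2 j \<equiv> (0, axis j 1)"

lemma val_Basis: "val1 j \<in> Basis" "val2 j \<in> Basis" "val1 j \<noteq> val2 j"
  by (auto simp: Basis_prod_def axis_eq_0_iff)

lemma inner_val: "v \<bullet> val1 j = fst v $ j" "v \<bullet> val2 j = snd v $ j"
  by (simp_all add: inner_prod_def inner_axis)

definition gj :: "'k \<Rightarrow> real \<Rightarrow> real" where "gj j = ratio_density M F (val1 j) (val2 j)"

lemmas gj_measurable [measurable] = dens_measurable[OF val_Basis, folded gj_def]
lemmas gj_nonneg = dens_nonneg[OF val_Basis, folded gj_def]
lemmas gj_pos = dens_pos[OF val_Basis, folded gj_def]
lemmas gj_continuous = dens_continuous[OF val_Basis, folded gj_def]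
lemmas integral_gj = integral_ratio[OF val_Basis, folded gj_def, unfolded inner_val]
lemmas integrable_gj = integrable_ratio[OF val_Basis, folded gj_def, unfolded inner_val]

lemma component_measurable [measurable]:
  "(\<lambda>v::(real^'k) \<times> (real^'k). fst v $ j) \<in> borel_measurable borel"
  "(\<lambda>v::(real^'k) \<times> (real^'k). snd v $ j) \<in> borel_measurable borel"
  unfolding inner_val[symmetric] by measurable

lemma component_bounds:
  fixes v :: "(real^'k) \<times> (real^'k)"
  assumes "v \<in> std_box M"
  shows "0 \<le> fst v $ j" "fst v $ j \<le> M" "0 \<le> snd v $ j" "snd v $ j \<le> M"
  using assms val_Basis[of j] unfolding mem_std_box inner_val[symmetric] by blast+

lemma integrable_F_times:
  assumes [measurable]: "k \<in> borel_measurable borel" and bound: "\<And>v. v \<in> std_box M \<Longrightarrow> \<bar>k v\<bar> \<le> C"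
  shows "integrable lborel (\<lambda>v. F v * k v)"
proof -
  obtain B where B: "B > 0" "\<And>v. F v \<le> B" using F_bounded by blast
  have "(0::(real^'k) \<times> (real^'k)) \<in> std_box M" using M_pos by (simp add: mem_std_box)
  then have C: "C \<ge> 0" using bound abs_ge_zero order_trans by blast
  show ?thesis
  proof (rule integrable_box_bounded)
    show "F v * k v = 0" if "v \<notin> std_box M" for v using that by (simp add: F_def)
    show "\<bar>F v * k v\<bar> \<le> B * C" for v
    proof (cases "v \<in> std_box M")
      case True
      then show ?thesis using B(1) B(2)[of v] F_nonneg[of v] bound[of v] by (auto simp: abs_mult intro!: mult_mono)
    next
      case False
      then show ?thesis using B C by (simp add: F_def)
    qed
  qed simp
qed

lemma gj_integrable: "integrable lborel (gj j)" "integrable lborel (\<lambda>u. gj j u * u)"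
proof -
  have "integrable lborel (\<lambda>v. F v * (fst v $ j))"
  proof (rule integrable_F_times)
    show "\<bar>fst v $ j\<bar> \<le> M" if "v \<in> std_box M" for v :: "(real^'k) \<times> (real^'k)"
      using component_bounds[OF that, of j] by simp
  qed simp
  then show "integrable lborel (gj j)" using integrable_gj[of "\<lambda>_. 1" j] by simp
  \<comment> \<open>The product is kept unsimplified because it is 0, not \<open>snd v $ j\<close>,
    when \<open>fst v $ j = 0\<close>; the bound by \<open>M\<close> holds in both cases.\<close>
  have "integrable lborel (\<lambda>v. F v * (fst v $ j * (snd v $ j / fst v $ j)))"
  proof (rule integrable_F_times)
    show "\<bar>fst v $ j * (snd v $ j / fst v $ j)\<bar> \<le> M" if "v \<in> std_box M" for v :: "(real^'k) \<times> (real^'k)"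
      using component_bounds[OF that, of j] M_pos by simp
  qed simp
  then show "integrable lborel (\<lambda>u. gj j u * u)" using integrable_gj[of "\<lambda>u. u" j] by (simp only: mult.assoc measurable_ident_sets[OF refl])
qed

definition g :: "real \<Rightarrow> real" where "g u = (\<Sum>j\<in>UNIV. gj j u)"
text \<open>Up to ties, bidder 1 wins an item exactly when the value ratio \<open>u\<close> is below
  \<open>r\<close>: \<open>A1\<close> is the expected value won, and \<open>m2 * B1\<close> the
  expected payment.\<close>

definition A1 :: "real \<Rightarrow> real" where "A1 r = (\<integral>u. g u * indicator {..<r} u \<partial>lborel)"
definition B1 :: "real \<Rightarrow> real" where "B1 r = (\<integral>u. g u * u * indicator {..<r} u \<partial>lborel)"
text \<open>\<open>A2\<close> and \<open>B2\<close> are complements of \<open>B1\<close> and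
  \<open>A1\<close>, so that their derivatives come for free; \<open>A2_B2_eq\<close> recovers the
  tail integrals over the event that bidder 2 wins.\<close>

definition A2 :: "real \<Rightarrow> real" where "A2 r = (\<integral>u. g u * u \<partial>lborel) - B1 r"
definition B2 :: "real \<Rightarrow> real" where "B2 r = (\<integral>u. g u \<partial>lborel) - A1 r"

lemma g_integrable: "integrable lborel g" "integrable lborel (\<lambda>u. g u * u)"
  unfolding g_def[abs_def] sum_distrib_right by (intro Bochner_Integration.integrable_sum gj_integrable)+

lemma g_indicator_integrable:
  assumes "S \<in> sets borel"
  shows "integrable lborel (\<lambda>u. g u * indicator S u)" "integrable lborel (\<lambda>u. g u * u * indicator S u)"
  using integrable_mult_indicator[of S lborel g] integrable_mult_indicator[of S lborel "\<lambda>u. g u * u"]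
    g_integrable assms by (simp_all add: mult.commute)

lemma g_pos: "u > 0 \<Longrightarrow> g u > 0"
  unfolding g_def by (intro sum_pos gj_pos) auto

lemma g_nonneg: "g u \<ge> 0"
  unfolding g_def by (intro sum_nonneg gj_nonneg)

lemma g_continuous: "continuous_on {0<..} g"
  unfolding g_def[abs_def] by (intro continuous_on_sum gj_continuous)

lemma cumulative_derivs:
  assumes "x > 0"
  shows "(A1 has_real_derivative g x) (at x)" "(B1 has_real_derivative g x * x) (at x)"
    "(A2 has_real_derivative - (g x * x)) (at x)" "(B2 has_real_derivative - g x) (at x)"
proof -
  show A1: "(A1 has_real_derivative g x) (at x)"
    unfolding A1_def[abs_def] using g_integrable(1) g_continuous assms by (rule has_real_derivative_cumulative)
  show B1: "(B1 has_real_derivative g x * x) (at x)"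
    unfolding B1_def[abs_def] by (rule has_real_derivative_cumulative[OF g_integrable(2) _ assms])
      (intro continuous_intros g_continuous)
  show "(A2 has_real_derivative - (g x * x)) (at x)" "(B2 has_real_derivative - g x) (at x)"
    unfolding A2_def[abs_def] B2_def[abs_def] by (auto intro!: derivative_eq_intros A1 B1)
qed

lemma A2_B2_eq:
  "A2 r = (\<integral>u. g u * u * indicator {r<..} u \<partial>lborel)" "B2 r = (\<integral>u. g u * indicator {r<..} u \<partial>lborel)"
proof -
  have *: "(\<integral>u. h u \<partial>lborel) - (\<integral>u. h u * indicator {..<r} u \<partial>lborel) = (\<integral>u. h u * indicator {r<..} u \<partial>lborel)"
    if int: "integrable lborel h" for h :: "real \<Rightarrow> real"
  proof -
    have [measurable]: "h \<in> borel_measurable borel" using int by auto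
    have ind: "integrable lborel (\<lambda>u. h u * indicator S u)" if "S \<in> sets borel" for S
      using integrable_mult_indicator[of S lborel h] int that by (simp add: mult.commute)
    have "(\<integral>u. h u \<partial>lborel) - (\<integral>u. h u * indicator {..<r} u \<partial>lborel) = (\<integral>u. h u - h u * indicator {..<r} u \<partial>lborel)"
      by (intro Bochner_Integration.integral_diff[symmetric] int ind) simp
    also have "\<dots> = (\<integral>u. h u * indicator {r<..} u \<partial>lborel)"
    proof (rule integral_cong_AE)
      show "AE u in lborel. h u - h u * indicator {..<r} u = h u * indicator {r<..} u"
        using AE_lborel_singleton[of r] by eventually_elim (auto simp: indicator_def)
    qed auto
    finally show ?thesis .
  qed
  show "A2 r = (\<integral>u. g u * u * indicator {r<..} u \<partial>lborel)" "B2 r = (\<integral>u. g u * indicator {r<..} u \<partial>lborel)"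
    unfolding A2_def B2_def A1_def B1_def by (simp_all add: * g_integrable)
qed

text \<open>The integrands of the differences are \<open>(r - u) * g u\<close> below
  \<open>r\<close> and \<open>(u - r) * g u\<close> above. The first two inequalities give the sign
  of a bidder's utility when its multiplier is 1; the third makes the equation for the second
  multiplier damped.\<close>

lemma cumulative_inequalities:
  assumes r: "r > 0"
  shows "B1 r < r * A1 r" "r * B2 r < A2 r" "0 < B2 r"
proof -
  have "0 < (\<integral>u. r * (g u * indicator {..<r} u) - g u * u * indicator {..<r} u \<partial>lborel)"
  proof (rule integral_pos_of_pos_on_interval[where c = 0 and d = r])
    show "integrable lborel (\<lambda>u. r * (g u * indicator {..<r} u) - g u * u * indicator {..<r} u)"
      by (intro Bochner_Integration.integrable_diff integrable_mult_right g_indicator_integrable) auto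
    show "0 \<le> r * (g u * indicator {..<r} u) - g u * u * indicator {..<r} u" for u
      using g_nonneg[of u] by (auto simp: indicator_def mult.commute intro!: mult_right_mono)
    show "0 < r * (g u * indicator {..<r} u) - g u * u * indicator {..<r} u" if "0 < u" "u < r" for u
      using g_pos[OF that(1)] that by (auto simp: indicator_def mult.commute)
  qed (rule r)
  then show "B1 r < r * A1 r"
    unfolding A1_def B1_def by (subst (asm) Bochner_Integration.integral_diff) (auto simp: g_indicator_integrable)
  have "0 < (\<integral>u. g u * u * indicator {r<..} u - r * (g u * indicator {r<..} u) \<partial>lborel)"
  proof (rule integral_pos_of_pos_on_interval[where c = r and d = "r + 1"])
    show "integrable lborel (\<lambda>u. g u * u * indicator {r<..} u - r * (g u * indicator {r<..} u))"
      by (intro Bochner_Integration.integrable_diff integrable_mult_right g_indicator_integrable) auto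
    show "0 \<le> g u * u * indicator {r<..} u - r * (g u * indicator {r<..} u)" for u
      using g_nonneg[of u] by (auto simp: indicator_def mult.commute intro!: mult_right_mono)
    show "0 < g u * u * indicator {r<..} u - r * (g u * indicator {r<..} u)" if "r < u" "u < r + 1" for u
      using g_pos[of u] r that by (auto simp: indicator_def mult.commute)
  qed simp
  then show "r * B2 r < A2 r"
    unfolding A2_B2_eq by (subst (asm) Bochner_Integration.integral_diff) (auto simp: g_indicator_integrable)
  show "0 < B2 r"
    unfolding A2_B2_eq
  proof (rule integral_pos_of_pos_on_interval[where c = r and d = "r + 1"])
    show "0 < g u * indicator {r<..} u" if "r < u" "u < r + 1" for u
      using g_pos[of u] r that by (auto simp: indicator_def)
  qed (auto simp: g_indicator_integrable g_nonneg)
qed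

text \<open>Per-item terms that are homogeneous of degree one in the two values depend on the ratio
  only, apart from the weight \<open>fst v $ j\<close>. Almost-everywhere equality suffices, which
  discards ties and zero values.\<close>

lemma integral_val_box:
  fixes \<psi> :: "real \<Rightarrow> real" and k :: "'k \<Rightarrow> (real^'k) \<times> (real^'k) \<Rightarrow> real"
  assumes [measurable]: "\<And>j. k j \<in> borel_measurable borel" "\<psi> \<in> borel_measurable borel"
    and bound: "\<And>j v. v \<in> std_box M \<Longrightarrow> \<bar>k j v\<bar> \<le> C"
    and AE: "\<And>j. AE v in lborel. v \<in> std_box M \<longrightarrow> k j v = fst v $ j * \<psi> (snd v $ j / fst v $ j)"
  shows "integral (val_box M) (\<lambda>v. f v * (\<Sum>j\<in>UNIV. k j v)) = (\<integral>u. g u * \<psi> u \<partial>lborel)"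
proof -
  have int: "integrable lborel (\<lambda>v. F v * k j v)" for j
    by (rule integrable_F_times) (use bound in auto)
  have eq: "indicator (std_box M) v *\<^sub>R (f v * (\<Sum>j\<in>UNIV. k j v)) = (\<Sum>j\<in>UNIV. F v * k j v)" for v
    by (simp add: F_def sum_distrib_left mult.assoc)
  have "set_integrable lborel (std_box M) (\<lambda>v. f v * (\<Sum>j\<in>UNIV. k j v))"
    unfolding set_integrable_def eq by (intro Bochner_Integration.integrable_sum int)
  then have "integral (val_box M) (\<lambda>v. f v * (\<Sum>j\<in>UNIV. k j v)) = (\<integral>v. (\<Sum>j\<in>UNIV. F v * k j v) \<partial>lborel)"
    unfolding val_box_eq_std_box by (subst set_borel_integral_eq_integral(2)[symmetric]) (simp_all only: set_lebesgue_integral_def eq)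
  also have "\<dots> = (\<Sum>j\<in>UNIV. (\<integral>v. F v * k j v \<partial>lborel))"
    by (intro Bochner_Integration.integral_sum int)
  also have "\<dots> = (\<Sum>j\<in>UNIV. (\<integral>u. gj j u * \<psi> u \<partial>lborel))"
  proof (rule sum.cong[OF refl])
    fix j
    have AE': "AE v in lborel. F v * k j v = F v * (fst v $ j) * \<psi> (snd v $ j / fst v $ j)"
      using AE[of j] by eventually_elim (auto simp: F_def indicator_def)
    then have "(\<integral>v. F v * k j v \<partial>lborel) = (\<integral>v. F v * (fst v $ j) * \<psi> (snd v $ j / fst v $ j) \<partial>lborel)"
      by (intro integral_cong_AE) auto
    then show "(\<integral>v. F v * k j v \<partial>lborel) = (\<integral>u. gj j u * \<psi> u \<partial>lborel)"
      by (simp add: integral_gj)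
  qed
  also have "\<dots> = (\<integral>u. (\<Sum>j\<in>UNIV. gj j u * \<psi> u) \<partial>lborel)"
  proof (rule Bochner_Integration.integral_sum[symmetric])
    fix j
    have AE': "AE v in lborel. F v * k j v = F v * (fst v $ j) * \<psi> (snd v $ j / fst v $ j)"
      using AE[of j] by eventually_elim (auto simp: F_def indicator_def)
    have "integrable lborel (\<lambda>v. F v * (fst v $ j) * \<psi> (snd v $ j / fst v $ j))"
      by (rule integrable_cong_AE_imp[OF int[of j]]) (use AE' in auto)
    then show "integrable lborel (\<lambda>u. gj j u * \<psi> u)" by (simp add: integrable_gj)
  qed
  finally show ?thesis by (simp add: g_def sum_distrib_right)
qed

lemma AE_no_tie:
  assumes "m1 > 0" "m2 > 0"
  shows "AE v in lborel. m1 * fst v $ j \<noteq> m2 * snd (v :: (real^'k) \<times> (real^'k)) $ j"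
proof -
  have "(m1 *\<^sub>R axis j 1, - (m2 *\<^sub>R axis j 1)) \<noteq> (0 :: (real^'k) \<times> (real^'k))"
    using assms by (auto simp: zero_prod_def axis_eq_0_iff)
  from AE_lborel_not_hyperplane[OF this, of 0] show ?thesis
    by eventually_elim (auto simp: inner_prod_def inner_axis')
qed

lemma U1_eq:
  assumes m: "m1 > 0" "m2 > 0"
  shows "U1 M f (m1, m2) = A1 (m1 / m2) - m2 * B1 (m1 / m2)"
proof -
  define r where "r = m1 / m2"
  \<comment> \<open>A win yields \<open>v1 - m2 * v2 = v1 * (1 - m2 * u)\<close> with
    \<open>u = v2 / v1\<close>.\<close>
  let ?\<psi> = "\<lambda>u::real. (1 - m2 * u) * indicator {..<r} u"
  let ?x = "\<lambda>j (v :: (real^'k) \<times> (real^'k)). sp_alloc (m1 * fst v $ j) (m2 * snd v $ j)"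
  have [measurable]: "(\<lambda>v. ?x j v) \<in> borel_measurable borel" for j
    unfolding sp_alloc_def by measurable
  have "U1 M f (m1, m2) = integral (val_box M) (\<lambda>v. f v * (\<Sum>j\<in>UNIV. fst v $ j * ?x j v - ?x j v * (m2 * snd v $ j)))"
    unfolding U1_def ros_util_def by (simp add: case_prod_beta')
  also have "\<dots> = (\<integral>u. g u * ?\<psi> u \<partial>lborel)"
  proof (rule integral_val_box[where C = "M + m2 * M"])
    fix j and v :: "(real^'k) \<times> (real^'k)" assume v: "v \<in> std_box M"
    note b = component_bounds[OF v, of j]
    have "\<bar>fst v $ j * ?x j v - ?x j v * (m2 * snd v $ j)\<bar> \<le> \<bar>fst v $ j * ?x j v\<bar> + \<bar>?x j v * (m2 * snd v $ j)\<bar>"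
      by linarith
    also have "\<dots> \<le> M * 1 + 1 * (m2 * M)"
      unfolding abs_mult using b m sp_alloc_bounds by (intro add_mono mult_mono) auto
    finally show "\<bar>fst v $ j * ?x j v - ?x j v * (m2 * snd v $ j)\<bar> \<le> M + m2 * M" by simp
  next
    fix j
    show "AE v in lborel. v \<in> std_box M \<longrightarrow> fst v $ j * ?x j v - ?x j v * (m2 * snd v $ j) = fst v $ j * ?\<psi> (snd v $ j / fst v $ j)"
      using AE_no_tie[OF m, of j]
    proof eventually_elim
      case (elim v)
      show ?case
      proof
        assume v: "v \<in> std_box M"
        note b = component_bounds[OF v, of j]
        show "fst v $ j * ?x j v - ?x j v * (m2 * snd v $ j) = fst v $ j * ?\<psi> (snd v $ j / fst v $ j)"
        proof (cases "fst v $ j = 0")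
          \<comment> \<open>A bidder 1 with value 0 who is not tied loses, so both sides are
            0.\<close>
          case True
          then show ?thesis using b m elim by (auto simp: sp_alloc_def mult_less_0_iff)
        next
          case False
          then have pos: "fst v $ j > 0" using b by simp
          have "snd v $ j / fst v $ j < r \<longleftrightarrow> m2 * snd v $ j < m1 * fst v $ j"
            using pos m by (simp add: r_def field_simps)
          then show ?thesis using pos elim by (auto simp: sp_alloc_def indicator_def field_simps)
        qed
      qed
    qed
  qed auto
  also have "\<dots> = (\<integral>u. g u * indicator {..<r} u - m2 * (g u * u * indicator {..<r} u) \<partial>lborel)"
    by (simp add: algebra_simps)
  also have "\<dots> = A1 r - m2 * B1 r"
    unfolding A1_def B1_def by (subst Bochner_Integration.integral_diff) (auto simp: g_indicator_integrable)
  finally show ?thesis by (simp add: r_def)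
qed

lemma U2_eq:
  assumes m: "m1 > 0" "m2 > 0"
  shows "U2 M f (m1, m2) = A2 (m1 / m2) - m1 * B2 (m1 / m2)"
proof -
  define r where "r = m1 / m2"
  let ?\<psi> = "\<lambda>u::real. (u - m1) * indicator {r<..} u"
  let ?x = "\<lambda>j (v :: (real^'k) \<times> (real^'k)). sp_alloc (m2 * snd v $ j) (m1 * fst v $ j)"
  have [measurable]: "(\<lambda>v. ?x j v) \<in> borel_measurable borel" for j
    unfolding sp_alloc_def by measurable
  have "U2 M f (m1, m2) = integral (val_box M) (\<lambda>v. f v * (\<Sum>j\<in>UNIV. snd v $ j * ?x j v - ?x j v * (m1 * fst v $ j)))"
    unfolding U2_def ros_util_def by (simp add: case_prod_beta')
  also have "\<dots> = (\<integral>u. g u * ?\<psi> u \<partial>lborel)"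
  proof (rule integral_val_box[where C = "M + m1 * M"])
    fix j and v :: "(real^'k) \<times> (real^'k)" assume v: "v \<in> std_box M"
    note b = component_bounds[OF v, of j]
    have "\<bar>snd v $ j * ?x j v - ?x j v * (m1 * fst v $ j)\<bar> \<le> \<bar>snd v $ j * ?x j v\<bar> + \<bar>?x j v * (m1 * fst v $ j)\<bar>"
      by linarith
    also have "\<dots> \<le> M * 1 + 1 * (m1 * M)"
      unfolding abs_mult using b m sp_alloc_bounds by (intro add_mono mult_mono) auto
    finally show "\<bar>snd v $ j * ?x j v - ?x j v * (m1 * fst v $ j)\<bar> \<le> M + m1 * M" by simp
  next
    fix j
    \<comment> \<open>Bidder 2 does win when bidder 1's value is 0, and the ratio is then
      meaningless; these profiles are removed as a null set.\<close>
    have "AE v in lborel. (val1 j) \<bullet> v \<noteq> 0"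
      by (rule AE_lborel_not_hyperplane) (auto simp: zero_prod_def axis_eq_0_iff)
    then show "AE v in lborel. v \<in> std_box M \<longrightarrow> snd v $ j * ?x j v - ?x j v * (m1 * fst v $ j) = fst v $ j * ?\<psi> (snd v $ j / fst v $ j)"
      using AE_no_tie[OF m, of j]
    proof eventually_elim
      case (elim v)
      show ?case
      proof
        assume v: "v \<in> std_box M"
        note b = component_bounds[OF v, of j]
        have pos: "fst v $ j > 0" using b elim by (auto simp: inner_commute[of "val1 j"] inner_val)
        have "r < snd v $ j / fst v $ j \<longleftrightarrow> m1 * fst v $ j < m2 * snd v $ j"
          using pos m by (simp add: r_def field_simps)
        then show "snd v $ j * ?x j v - ?x j v * (m1 * fst v $ j) = fst v $ j * ?\<psi> (snd v $ j / fst v $ j)"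
          using pos elim by (auto simp: sp_alloc_def indicator_def field_simps)
      qed
    qed
  qed auto
  also have "\<dots> = (\<integral>u. g u * u * indicator {r<..} u - m1 * (g u * indicator {r<..} u) \<partial>lborel)"
    by (simp add: algebra_simps)
  also have "\<dots> = A2 r - m1 * B2 r"
    unfolding A2_B2_eq by (subst Bochner_Integration.integral_diff) (auto simp: g_indicator_integrable)
  finally show ?thesis by (simp add: r_def)
qed

end

lemma smooth_density_ros:
  assumes "smooth_density M f"
  shows "ros M f"
proof
  obtain S f' where S: "val_box M \<subseteq> S" "\<forall>x\<in>S. (f has_derivative blinfun_apply (f' x)) (at x)"
    using assms unfolding smooth_density_def by blast
  then have "f differentiable_on val_box M"
    by (auto simp: differentiable_on_def differentiable_def intro: has_derivative_at_withinI)
  then show "continuous_on (std_box M) f"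
    unfolding val_box_eq_std_box[symmetric] by (rule differentiable_imp_continuous_on)
qed (use assms in \<open>auto simp: smooth_density_def val_box_eq_std_box\<close>)

section \<open>Convergence to equilibrium\<close>

theorem theorem2:
  fixes M :: real
    and f :: "(real^'k::finite) \<times> (real^'k) \<Rightarrow> real"
    and m :: "real \<Rightarrow> real \<times> real"
  assumes dens: "smooth_density M f"
    and ode: "\<forall>t\<ge>0. (m has_vector_derivative (U1 M f (m t), U2 M f (m t))) (at t within {0..})"
    and init: "fst (m 0) > 1" "snd (m 0) > 1"
    and bdd: "bounded (m ` {0..})"
  shows "\<exists>mstar. (m \<longlongrightarrow> mstar) at_top \<and> U1 M f mstar = 0 \<and> U2 M f mstar = 0"
proof -
  interpret ros M f by (rule smooth_density_ros[OF dens])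
  define p where "p t = fst (m t)" for t
  define q where "q t = snd (m t)" for t
  have m_eq: "m t = (p t, q t)" for t by (simp add: p_def q_def)
  have p_within: "(p has_real_derivative U1 M f (m t)) (at t within {0..})"
    and q_within: "(q has_real_derivative U2 M f (m t)) (at t within {0..})" if "t \<ge> 0" for t
    using bounded_linear.has_vector_derivative[OF bounded_linear_fst ode[rule_format, OF that]]
      bounded_linear.has_vector_derivative[OF bounded_linear_snd ode[rule_format, OF that]]
    by (simp_all add: p_def[abs_def] q_def[abs_def] has_real_derivative_iff_has_vector_derivative)
  have at: "at t within {0..} = at t" if "t > 0" for t :: real
    using that by (intro at_within_interior) simp
  have p_deriv: "(p has_real_derivative U1 M f (p t, q t)) (at t)"
    and q_deriv: "(q has_real_derivative U2 M f (p t, q t)) (at t)" if "t > 0" for t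
    using p_within[of t] q_within[of t] that by (simp_all add: at m_eq)
  have pq_cont: "continuous_on {0..} p" "continuous_on {0..} q"
    using p_within q_within by (auto simp: continuous_on_eq_continuous_within intro: DERIV_continuous)
  have above: "p t > 1 \<and> q t > 1" if "t \<ge> 0" for t
  proof (rule stays_above_one[OF pq_cont _ _ _ _ that])
    show "p 0 > 1" "q 0 > 1" using init by (simp_all add: p_def q_def)
    show "\<exists>D>0. (p has_real_derivative D) (at u)" if u: "u > 0" "p u = 1" "q u \<ge> 1" for u
    proof -
      have "0 < A1 (1 / q u) - q u * B1 (1 / q u)"
        using cumulative_inequalities(1)[of "1 / q u"] u by (simp add: field_simps)
      moreover have "(p has_real_derivative A1 (1 / q u) - q u * B1 (1 / q u)) (at u)"
        using p_deriv[OF u(1)] u by (simp add: U1_eq)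
      ultimately show ?thesis by blast
    qed
    show "\<exists>D>0. (q has_real_derivative D) (at u)" if u: "u > 0" "q u = 1" "p u \<ge> 1" for u
    proof -
      have "0 < A2 (p u) - p u * B2 (p u)"
        using cumulative_inequalities(2)[of "p u"] u by simp
      moreover have "(q has_real_derivative A2 (p u) - p u * B2 (p u)) (at u)"
        using q_deriv[OF u(1)] u by (simp add: U2_eq)
      ultimately show ?thesis by blast
    qed
  qed
  obtain C where C: "\<And>t. t \<ge> 0 \<Longrightarrow> norm (m t) \<le> C" using bdd by (auto simp: bounded_iff)
  have le_C: "p t \<le> C" "q t \<le> C" if "t \<ge> 0" for t
    using C[OF that] norm_fst_le[of "p t" "q t"] norm_snd_le[of "q t" "p t"] above[OF that] by (auto simp: m_eq)
  have C1: "C > 1" using le_C[of 0] above[of 0] by auto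
  define r where "r t = p t / q t" for t
  define a where "a x = A1 x - x * A2 x" for x
  define b where "b x = B1 x - x\<^sup>2 * B2 x" for x
  have pr: "p t = r t * q t" if "t > 0" for t using above[of t] that by (simp add: r_def)
  have U_eq: "U1 M f (p t, q t) = A1 (r t) - q t * B1 (r t)" "U2 M f (p t, q t) = A2 (r t) - p t * B2 (r t)" if "t > 0" for t
    using above[of t] that by (simp_all add: U1_eq U2_eq r_def)
  have r_bounds: "r t \<in> {1 / C..C}" if "t > 0" for t
  proof -
    have "1 / C \<le> p t / q t" using above[of t] le_C[of t] that C1 by (intro frac_le) auto
    moreover have "p t / q t \<le> C / 1" using above[of t] le_C[of t] that C1 by (intro frac_le) auto
    ultimately show ?thesis by (simp add: r_def)
  qed
  interpret flow: ratio_flow a b A2 B2 g r q "1 / C" C C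
  proof
    show "0 < 1 / C" using C1 by simp
    show "continuous_on {0<..} A2" "continuous_on {0<..} B2"
      using cumulative_derivs(3,4) by (auto intro!: continuous_at_imp_continuous_on DERIV_isCont)
    show "(a has_real_derivative (1 + x\<^sup>2) * g x - A2 x) (at x)" if "x > 0" for x
      unfolding a_def[abs_def]
      by (auto intro!: derivative_eq_intros cumulative_derivs that simp: algebra_simps power2_eq_square)
    show "(b has_real_derivative (x + x\<^sup>2) * g x - 2 * x * B2 x) (at x)" if "x > 0" for x
      unfolding b_def[abs_def]
      by (auto intro!: derivative_eq_intros cumulative_derivs that simp: algebra_simps power2_eq_square)
    fix t :: real assume t: "t > 0"
    have q0: "q t \<noteq> 0" using above[of t] t by auto
    have "(r has_real_derivative (U1 M f (p t, q t) * q t - p t * U2 M f (p t, q t)) / (q t * q t)) (at t)"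
      unfolding r_def[abs_def] by (rule DERIV_divide[OF p_deriv[OF t] q_deriv[OF t] q0])
    also have "(U1 M f (p t, q t) * q t - p t * U2 M f (p t, q t)) / (q t * q t) = (a (r t) - b (r t) * q t) / q t"
      using q0 unfolding U_eq[OF t] a_def b_def unfolding pr[OF t] by (simp add: field_simps power2_eq_square)
    finally show "(r has_real_derivative (a (r t) - b (r t) * q t) / q t) (at t)" .
    show "(q has_real_derivative A2 (r t) - r t * q t * B2 (r t)) (at t)"
      using q_deriv[OF t] unfolding U_eq[OF t] unfolding pr[OF t] .
    show "r t \<in> {1 / C..C}" by (rule r_bounds[OF t])
    show "1 < q t \<and> q t \<le> C" using above[of t] le_C[of t] t by simp
    show "1 < r t * q t" using above[of t] t pr[OF t] by simp
  qed (use g_continuous g_pos in auto)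
  obtain l where l: "(r \<longlongrightarrow> l) at_top"
  proof (rule ccontr)
    assume "\<not> thesis"
    then have nonconv: "\<not> (\<exists>l. (r \<longlongrightarrow> l) at_top)" using that by blast
    have bounds: "\<forall>\<^sub>F t in at_top. 1 / C \<le> r t \<and> r t \<le> C"
      using eventually_gt_at_top[of 0] by eventually_elim (use r_bounds in auto)
    show False
    proof (rule oscillation_bounds[OF bounds nonconv])
      fix r1 r2 :: real
      assume osc: "r1 < r2"
        "\<And>x. x < r1 \<Longrightarrow> \<forall>\<^sub>F t in at_top. x < r t" "\<And>x. x > r2 \<Longrightarrow> \<forall>\<^sub>F t in at_top. r t < x"
        "\<And>x. x > r1 \<Longrightarrow> \<exists>\<^sub>F t in at_top. r t < x" "\<And>x. x < r2 \<Longrightarrow> \<exists>\<^sub>F t in at_top. x < r t"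
      interpret oscillating_ratio_flow a b A2 B2 g r q "1 / C" C C r1 r2
        by unfold_locales (fact osc)+
      show False by (rule no_oscillation)
    qed
  qed
  have "1 / C \<le> l"
    by (rule tendsto_lowerbound[OF l eventually_mono[OF eventually_gt_at_top[of 0]]]) (use r_bounds in auto)
  then have l_pos: "l > 0" using C1 zero_less_divide_1_iff[of C] by linarith
  have comp: "((\<lambda>t. h (r t)) \<longlongrightarrow> h l) at_top" if "\<And>x. x > 0 \<Longrightarrow> \<exists>D. (h has_real_derivative D) (at x)" for h
    using that[OF l_pos] l DERIV_isCont isCont_tendsto_compose by blast
  have lims: "((\<lambda>t. A1 (r t)) \<longlongrightarrow> A1 l) at_top" "((\<lambda>t. B1 (r t)) \<longlongrightarrow> B1 l) at_top"
    "((\<lambda>t. A2 (r t)) \<longlongrightarrow> A2 l) at_top" "((\<lambda>t. B2 (r t)) \<longlongrightarrow> B2 l) at_top"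
    by (rule comp, use cumulative_derivs in blast)+
  define y where "y = A2 l / (l * B2 l)"
  have q_lim: "(q \<longlongrightarrow> y) at_top"
    unfolding y_def
  proof (rule linear_ode_limit)
    show "(q has_real_derivative A2 (r t) - (r t * B2 (r t)) * q t) (at t)" if "t > 0" for t
      using flow.s_deriv[OF that] by (simp add: mult_ac)
    show "((\<lambda>t. r t * B2 (r t)) \<longlongrightarrow> l * B2 l) at_top" by (intro tendsto_intros l lims)
    show "l * B2 l > 0" using l_pos cumulative_inequalities(3) by simp
    show "\<bar>q t\<bar> \<le> C" if "t > 0" for t using above[of t] le_C[of t] that by simp
  qed (rule lims)
  have "1 \<le> y"
    by (rule tendsto_lowerbound[OF q_lim eventually_mono[OF eventually_gt_at_top[of 0]]]) (use above in \<open>auto simp: less_imp_le\<close>)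
  then have y_pos: "y > 0" by simp
  have p_lim: "(p \<longlongrightarrow> l * y) at_top"
  proof (rule Lim_transform_eventually)
    show "((\<lambda>t. r t * q t) \<longlongrightarrow> l * y) at_top" by (intro tendsto_intros l q_lim)
    show "\<forall>\<^sub>F t in at_top. r t * q t = p t" using eventually_gt_at_top[of 0] by eventually_elim (simp add: pr)
  qed
  have ratio: "l * y / y = l" using y_pos by simp
  have "U1 M f (l * y, y) = 0"
  proof (rule bounded_imp_deriv_limit_zero)
    show "(p has_real_derivative A1 (r t) - q t * B1 (r t)) (at t)" if "t > 0" for t
      using p_deriv[OF that] U_eq[OF that] by simp
    have "((\<lambda>t. A1 (r t) - q t * B1 (r t)) \<longlongrightarrow> A1 l - y * B1 l) at_top" by (intro tendsto_intros lims q_lim)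
    then show "((\<lambda>t. A1 (r t) - q t * B1 (r t)) \<longlongrightarrow> U1 M f (l * y, y)) at_top"
      using l_pos y_pos ratio by (simp add: U1_eq)
    show "\<bar>p t\<bar> \<le> C" if "t > 0" for t using above[of t] le_C[of t] that by simp
  qed
  moreover have "U2 M f (l * y, y) = 0"
  proof (rule bounded_imp_deriv_limit_zero)
    show "(q has_real_derivative A2 (r t) - p t * B2 (r t)) (at t)" if "t > 0" for t
      using q_deriv[OF that] U_eq[OF that] by simp
    have "((\<lambda>t. A2 (r t) - p t * B2 (r t)) \<longlongrightarrow> A2 l - l * y * B2 l) at_top" by (intro tendsto_intros lims p_lim)
    then show "((\<lambda>t. A2 (r t) - p t * B2 (r t)) \<longlongrightarrow> U2 M f (l * y, y)) at_top"
      using l_pos y_pos ratio by (simp add: U2_eq)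
    show "\<bar>q t\<bar> \<le> C" if "t > 0" for t using above[of t] le_C[of t] that by simp
  qed
  moreover have "(m \<longlongrightarrow> (l * y, y)) at_top"
    unfolding m_eq[abs_def] using p_lim q_lim by (rule tendsto_Pair)
  ultimately show ?thesis by blast
qed

end
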